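(* Let $n\ge3$, let $K_{n-1}$ also denote the graphic matroid of the complete graph on the vertices $\{1,\ldots,n-1\}$ (ground set the $\binom{n-1}2$ edges), and let $L=\mathbb R\cdot(1,\ldots,1)\subseteq\mathbb R^{\binom{n-1}2}$. The linear map $$f:\mathbb R^{\binom{n-1}{2}}/L\to\mathbb R^{\binom n2}/\operatorname{Im}(\phi_n),\quad (a_{i,j})_{i,j}\mapsto(b_{i,j})_{i,j},\qquad b_{i,j}=\begin{cases}0,&n\in\{i,j\},\\2a_{i,j},&\text{else,}\end{cases}$$ is well defined and is an isomorphism of vector spaces; it maps the lattice $\mathbb Z^{\binom{n-1}2}/(\mathbb Z\cdot(1,\ldots,1))$ isomorphically onto $\Lambda_n$, and it restricts to a bijection from $B(K_{n-1})/L$ onto $\mathcal M_n$. In other words, $f$ induces a tropical isomorphism between $B(K_{n-1})/L$ and the moduli space $\mathcal M_n$ of $n$-marked abstract rational tropical curves.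
   Context: Matroid varieties. For a loopfree matroid $M$ on a finite set $S$ and $F\subseteq S$ put $V_F=-\sum_{i\in F}e_i\in\mathbb R^S$. $B(M)$ is the tropical cycle in $\mathbb R^S$ given by the fan of cones $\{\sum_{i=1}^p\lambda_iV_{F_i}:\lambda_1,\ldots,\lambda_{p-1}\ge0,\lambda_p\in\mathbb R\}$ for chains of flats $\emptyset\subsetneq F_1\subsetneq\cdots\subsetneq F_p=S$ of $M$, with all weights $1$. It is invariant under translations by $L=\mathbb R\cdot(1,\ldots,1)$, and $B(M)/L$ is the image cycle in $\mathbb R^S/L$ (weights $1$, lattice the image of $\mathbb Z^S$). Moduli space. An $n$-marked abstract rational tropical curve is a metric tree whose inner vertices have valence at least $3$, with bounded internal edges of positive length and $n$ unbounded leaves labelled $1,\ldots,n$. Coordinates of $\mathbb R^{\binom n2}$ are indexed by $2$-subsets $\{i,j\}$ of $\{1,\ldots,n\}$, and $\phi_n:\mathbb R^n\to\mathbb R^{\binom n2}$ is the linear map $(a_1,\ldots,a_n)\mapsto(a_i+a_j)_{i,j}$. A curve is sent to the class in $\mathbb R^{\binom n2}/\operatorname{Im}(\phi_n)$ of the vector whose $\{i,j\}$ entry is the distance between (the inner end vertices of) the leaves $i$ and $j$, i.e. the total length of bounded edges on the path joining them. $\mathcal M_n$ is the image of this (injective) map, which is a fan (one cone for each combinatorial type of tree), equipped with weight $1$ on every facet; it is a tropical cycle with respect to the lattice $\Lambda_n\subseteq\mathbb R^{\binom n2}/\operatorname{Im}(\phi_n)$ generated by the classes of the curves having exactly one bounded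 edge, of length $1$. A tropical isomorphism is a bijection of supports respecting weights that is induced by a linear map which is an isomorphism of the lattices. *)

theory Defs
  imports
    Complex_Main
    "HOL-Library.Function_Algebras"
    "HOL-Library.Set_Algebras"
    "HOL-Library.Indicator_Function"
begin

section \<open>Coordinate spaces and their quotients\<close>

instantiation "fun" :: (type, real_vector) real_vector
begin

definition scaleR_fun :: "real \<Rightarrow> ('a \<Rightarrow> 'b) \<Rightarrow> 'a \<Rightarrow> 'b" where
  "scaleR_fun c f = (\<lambda>x. c *\<^sub>R f x)"

instance
  by standard (simp_all add: scaleR_fun_def fun_eq_iff scaleR_add_left scaleR_add_right)

end

text \<open>\<open>\<real>\<^sup>S\<close> consists of the functions that vanish outside \<open>S\<close>.\<close>

definition coord_space :: "'a set \<Rightarrow> ('a \<Rightarrow> real) set" where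
  "coord_space S = {x. \<forall>s. s \<notin> S \<longrightarrow> x s = 0}"

definition int_coord_space :: "'a set \<Rightarrow> ('a \<Rightarrow> real) set" where
  "int_coord_space S = {x \<in> coord_space S. \<forall>s. x s \<in> \<int>}"

text \<open>Points of a quotient \<open>V/W\<close> are cosets \<open>x +o W\<close>; they are added as sets of vectors.\<close>

definition coset_space :: "'v::real_vector set \<Rightarrow> 'v set \<Rightarrow> 'v set set" where
  "coset_space V W = (\<lambda>x. x +o W) ` V"

text \<open>Adding \<open>W\<close> only matters for \<open>c = 0\<close>.\<close>

definition coset_scale :: "'v::real_vector set \<Rightarrow> real \<Rightarrow> 'v set \<Rightarrow> 'v set" where
  "coset_scale W c A = ((\<lambda>a. c *\<^sub>R a) ` A) + W"

definition quot_linear ::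
  "'v::real_vector set \<Rightarrow> 'v set \<Rightarrow> 'u::real_vector set \<Rightarrow> 'u set \<Rightarrow> ('v set \<Rightarrow> 'u set) \<Rightarrow> bool" where
  "quot_linear V W V' W' F \<longleftrightarrow>
     F ` coset_space V W \<subseteq> coset_space V' W' \<and>
     (\<forall>A\<in>coset_space V W. \<forall>B\<in>coset_space V W. F (A + B) = F A + F B) \<and>
     (\<forall>c. \<forall>A\<in>coset_space V W. F (coset_scale W c A) = coset_scale W' c (F A))"

text \<open>The subgroup of a quotient by \<open>W\<close> generated by a set \<open>G\<close> of cosets.\<close>

inductive_set generated_subgroup :: "'v::real_vector set \<Rightarrow> 'v set set \<Rightarrow> 'v set set"
  for W G where
  zero: "W \<in> generated_subgroup W G"
| gen: "A \<in> G \<Longrightarrow> A \<in> generated_subgroup W G"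
| add: "A \<in> generated_subgroup W G \<Longrightarrow> B \<in> generated_subgroup W G \<Longrightarrow>
    A + B \<in> generated_subgroup W G"
| neg: "A \<in> generated_subgroup W G \<Longrightarrow> coset_scale W (-1) A \<in> generated_subgroup W G"


section \<open>Weighted fans in quotient spaces\<close>

text \<open>A fan in \<open>total/modulus\<close>, given by its closed cones; only the weights of its facets are
  meaningful.\<close>

record 'v weighted_fan =
  total :: "'v set"
  modulus :: "'v set"
  cones :: "'v set set set"
  weight :: "'v set set \<Rightarrow> int"
  lattice :: "'v set set"

definition facets :: "'v weighted_fan \<Rightarrow> 'v set set set" where
  "facets X = {\<sigma> \<in> cones X. \<forall>\<tau> \<in> cones X. \<sigma> \<subseteq> \<tau> \<longrightarrow> \<sigma> = \<tau>}"

definition support :: "'v weighted_fan \<Rightarrow> 'v set set" where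
  "support X = \<Union> (cones X)"

text \<open>The relative interior of a convex set \<open>\<sigma>\<close> in a quotient by \<open>W\<close>: every segment from a point
  \<open>B\<close> of \<open>\<sigma>\<close> to \<open>A\<close> can be prolonged beyond \<open>A\<close> inside \<open>\<sigma>\<close>.\<close>

definition coset_rel_interior :: "'v::real_vector set \<Rightarrow> 'v set set \<Rightarrow> 'v set set" where
  "coset_rel_interior W \<sigma> =
     {A \<in> \<sigma>. \<forall>B\<in>\<sigma>. \<exists>\<epsilon>>0. coset_scale W (1 + \<epsilon>) A + coset_scale W (-\<epsilon>) B \<in> \<sigma>}"

text \<open>The two fan structures need not correspond cone by cone (one may be finer than the other), so
  weights are compared wherever the relative interiors of two facets meet.\<close>

definition respects_weights ::
  "'v::real_vector weighted_fan \<Rightarrow> 'u::real_vector weighted_fan \<Rightarrow> ('v set \<Rightarrow> 'u set) \<Rightarrow> bool" where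
  "respects_weights X Y F \<longleftrightarrow>
     (\<forall>\<sigma>\<in>facets X. \<forall>\<tau>\<in>facets Y.
        F ` coset_rel_interior (modulus X) \<sigma> \<inter> coset_rel_interior (modulus Y) \<tau> \<noteq> {} \<longrightarrow>
        weight X \<sigma> = weight Y \<tau>)"

definition tropical_isomorphism ::
  "'v::real_vector weighted_fan \<Rightarrow> 'u::real_vector weighted_fan \<Rightarrow> ('v set \<Rightarrow> 'u set) \<Rightarrow> bool" where
  "tropical_isomorphism X Y F \<longleftrightarrow>
     quot_linear (total X) (modulus X) (total Y) (modulus Y) F \<and>
     bij_betw F (lattice X) (lattice Y) \<and>
     bij_betw F (support X) (support Y) \<and>
     respects_weights X Y F"


section \<open>Finite simple graphs\<close>

text \<open>Edges are two-element sets of vertices.\<close>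

definition pairs :: "nat \<Rightarrow> nat set set" where
  "pairs m = {e. e \<subseteq> {1..m} \<and> card e = 2}"

definition path_edges :: "'a list \<Rightarrow> 'a set set" where
  "path_edges p = {{p ! k, p ! Suc k} | k. Suc k < length p}"

definition is_path :: "'a set set \<Rightarrow> 'a \<Rightarrow> 'a list \<Rightarrow> 'a \<Rightarrow> bool" where
  "is_path E u p v \<longleftrightarrow>
     p \<noteq> [] \<and> hd p = u \<and> last p = v \<and> distinct p \<and> path_edges p \<subseteq> E"

definition is_cycle :: "'a set set \<Rightarrow> 'a list \<Rightarrow> bool" where
  "is_cycle E p \<longleftrightarrow>
     3 \<le> length p \<and> distinct p \<and> path_edges p \<subseteq> E \<and> {last p, hd p} \<in> E"

definition acyclic_edges :: "'a set set \<Rightarrow> bool" where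
  "acyclic_edges E \<longleftrightarrow> (\<nexists>p. is_cycle E p)"

definition is_tree :: "'a set \<Rightarrow> 'a set set \<Rightarrow> bool" where
  "is_tree V E \<longleftrightarrow>
     finite V \<and> V \<noteq> {} \<and> (\<forall>e\<in>E. e \<subseteq> V \<and> card e = 2) \<and>
     (\<forall>u\<in>V. \<forall>v\<in>V. \<exists>p. is_path E u p v) \<and> acyclic_edges E"


section \<open>Matroid varieties\<close>

text \<open>A matroid is represented by its ground set and its independence predicate.\<close>

definition matroid_rank :: "('a set \<Rightarrow> bool) \<Rightarrow> 'a set \<Rightarrow> nat" where
  "matroid_rank indep A = Max (card ` {I. I \<subseteq> A \<and> indep I})"

definition is_flat :: "'a set \<Rightarrow> ('a set \<Rightarrow> bool) \<Rightarrow> 'a set \<Rightarrow> bool" where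
  "is_flat S indep F \<longleftrightarrow>
     F \<subseteq> S \<and> (\<forall>s\<in>S - F. matroid_rank indep F < matroid_rank indep (insert s F))"

definition graphic_indep :: "'a set set \<Rightarrow> 'a set set \<Rightarrow> bool" where
  "graphic_indep E I \<longleftrightarrow> I \<subseteq> E \<and> acyclic_edges I"

definition flat_vector :: "'a set \<Rightarrow> 'a \<Rightarrow> real" where
  "flat_vector F = - (\<Sum>i\<in>F. indicator {i})"

text \<open>The set \<open>{F\<^sub>1, \<dots>, F\<^sub>p}\<close> of members of a chain of nonempty flats with \<open>F\<^sub>p = S\<close>.\<close>

definition flat_chain :: "'a set \<Rightarrow> ('a set \<Rightarrow> bool) \<Rightarrow> 'a set set \<Rightarrow> bool" where
  "flat_chain S indep C \<longleftrightarrow>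
     finite C \<and> subset.chain {F. is_flat S indep F \<and> F \<noteq> {}} C \<and> S \<in> C"

definition chain_cone :: "'a set \<Rightarrow> 'a set set \<Rightarrow> ('a \<Rightarrow> real) set" where
  "chain_cone S C = {\<Sum>F\<in>C. c F *\<^sub>R flat_vector F | c. \<forall>F\<in>C - {S}. 0 \<le> c F}"

definition all_ones_line :: "'a set \<Rightarrow> ('a \<Rightarrow> real) set" where
  "all_ones_line S = span {indicator S}"

text \<open>The cycle \<open>B(M)/L\<close>. Every \<open>chain_cone S C\<close> is invariant under translation by \<open>L\<close>, since the
  coefficient of \<open>flat_vector S\<close> is unrestricted.\<close>

definition matroid_fan_mod_line ::
  "'a set \<Rightarrow> ('a set \<Rightarrow> bool) \<Rightarrow> ('a \<Rightarrow> real) weighted_fan" where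
  "matroid_fan_mod_line S indep =
     \<lparr>total = coord_space S,
      modulus = all_ones_line S,
      cones = {(\<lambda>x. x +o all_ones_line S) ` chain_cone S C | C. flat_chain S indep C},
      weight = (\<lambda>_. 1),
      lattice = (\<lambda>x. x +o all_ones_line S) ` int_coord_space S\<rparr>"


section \<open>Abstract rational tropical curves\<close>

text \<open>The combinatorial type of a marked curve: the tree formed by the inner vertices and the bounded
  edges, and for each label the inner end vertex of the corresponding leaf. Naming the inner vertices
  by natural numbers is no restriction, as trees are finite.\<close>

record marked_tree =
  verts :: "nat set"
  edges :: "nat set set"
  leaf_end :: "nat \<Rightarrow> nat"

definition valence :: "nat \<Rightarrow> marked_tree \<Rightarrow> nat \<Rightarrow> nat" where
  "valence n T v = card {e \<in> edges T. v \<in> e} + card {i \<in> {1..n}. leaf_end T i = v}"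

definition is_marked_tree :: "nat \<Rightarrow> marked_tree \<Rightarrow> bool" where
  "is_marked_tree n T \<longleftrightarrow>
     is_tree (verts T) (edges T) \<and> leaf_end T ` {1..n} \<subseteq> verts T \<and>
     (\<forall>v\<in>verts T. 3 \<le> valence n T v)"

definition tree_dist :: "'a set set \<Rightarrow> ('a set \<Rightarrow> real) \<Rightarrow> 'a \<Rightarrow> 'a \<Rightarrow> real" where
  "tree_dist E len u v = (\<Sum>e\<in>path_edges (THE p. is_path E u p v). len e)"

text \<open>The entry at \<open>{i, j}\<close> is the distance of the leaves \<open>i\<close> and \<open>j\<close>; as distances are symmetric,
  the pair may be listed in increasing order.\<close>

definition distance_vector :: "nat \<Rightarrow> marked_tree \<Rightarrow> (nat set \<Rightarrow> real) \<Rightarrow> nat set \<Rightarrow> real" where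
  "distance_vector n T len =
     (\<lambda>e. if e \<in> pairs n
          then tree_dist (edges T) len (leaf_end T (Min e)) (leaf_end T (Max e)) else 0)"

definition phi :: "nat \<Rightarrow> (nat \<Rightarrow> real) \<Rightarrow> nat set \<Rightarrow> real" where
  "phi n a = (\<lambda>e. if e \<in> pairs n then \<Sum>i\<in>e. a i else 0)"

definition Im_phi :: "nat \<Rightarrow> (nat set \<Rightarrow> real) set" where
  "Im_phi n = phi n ` coord_space {1..n}"

definition curve_class ::
  "nat \<Rightarrow> marked_tree \<Rightarrow> (nat set \<Rightarrow> real) \<Rightarrow> (nat set \<Rightarrow> real) set" where
  "curve_class n T len = distance_vector n T len +o Im_phi n"

definition moduli_space :: "nat \<Rightarrow> (nat set \<Rightarrow> real) set set" where
  "moduli_space n =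
     {curve_class n T len | T len. is_marked_tree n T \<and> (\<forall>e\<in>edges T. 0 < len e)}"

definition moduli_lattice :: "nat \<Rightarrow> (nat set \<Rightarrow> real) set set" where
  "moduli_lattice n =
     generated_subgroup (Im_phi n)
       {curve_class n T len | T len.
          is_marked_tree n T \<and> card (edges T) = 1 \<and> (\<forall>e\<in>edges T. len e = 1)}"

text \<open>The closed cone of a combinatorial type; length \<open>0\<close> amounts to contracting an edge.\<close>

definition type_cone :: "nat \<Rightarrow> marked_tree \<Rightarrow> (nat set \<Rightarrow> real) set set" where
  "type_cone n T = {curve_class n T len | len. \<forall>e\<in>edges T. 0 \<le> len e}"

definition moduli_fan :: "nat \<Rightarrow> (nat set \<Rightarrow> real) weighted_fan" where
  "moduli_fan n =
     \<lparr>total = coord_space (pairs n),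
      modulus = Im_phi n,
      cones = {type_cone n T | T. is_marked_tree n T},
      weight = (\<lambda>_. 1),
      lattice = moduli_lattice n\<rparr>"


section \<open>The comparison map\<close>

text \<open>On representatives; entries at \<open>e \<notin> pairs n\<close> are \<open>0\<close> because \<open>a\<close> vanishes there.\<close>

definition comparison_map :: "nat \<Rightarrow> (nat set \<Rightarrow> real) \<Rightarrow> nat set \<Rightarrow> real" where
  "comparison_map n a = (\<lambda>e. if n \<in> e then 0 else 2 * a e)"

end

theory Submission
  imports Defs "HOL-Library.Nat_Bijection"
begin

text \<open>An edge \<open>e\<close> of a tree cuts the leaves into two parts; let \<open>J\<close> be the part not containing
  \<open>n\<close>. Modulo \<open>Im \<phi>\<^sub>n\<close> the curve whose only edge is \<open>e\<close>, with length \<open>1\<close>, is the image of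
  \<open>V\<^bsub>K(J)\<^esub>\<close>, where \<open>K(J)\<close> is the clique on \<open>J\<close>. So a general curve is the image of
  \<open>a = \<Sum>\<^sub>e len(e) V\<^bsub>K(J\<^sub>e)\<^esub>\<close>, and the sets \<open>J\<^sub>e\<close> form a laminar family, which makes \<open>a\<close> an
  ultrametric. The flats of the matroid of a complete graph are the transitive sets of pairs, hence
  the sublevel sets of \<open>a\<close> form a chain of flats whose cone contains \<open>a\<close>. Conversely, the
  nontrivial blocks of the flats of a chain form a laminar family, and a laminar family is the family
  of the sets \<open>J\<^sub>e\<close> of a tree.\<close>

section \<open>Cosets and coordinate vectors\<close>

text \<open>The factor 2 comes from the identity [x \<noteq> y] = x + y - 2 [x \<and> y] for truth
  values: if x and y tell whether an edge cuts the leaves i and j off from n, the first two terms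
  lie in the image of \<open>phi n\<close>, and the last one is twice the entry of a clique vector.
  Paths are awkward to manipulate, so facts about trees go through two-colourings of the vertices
  that change colour along a single edge: acyclicity, uniqueness of paths, distances and laminarity
  all follow from these. The fans do not match cone by cone: a chain of flats also records the order
  in which blocks merge, a tree does not, so several chain cones may cover one cone of trees.
  Therefore only points are transported: a curve to some chain cone containing its preimage, a point
  of a chain cone to a tree built for it.\<close>

lemma sum_fun_apply: "(\<Sum>i\<in>A. f i) x = (\<Sum>i\<in>A. f i x)"
  for f :: "'i \<Rightarrow> 'a \<Rightarrow> 'b::comm_monoid_add"
  by (induction A rule: infinite_finite_induct) simp_all

lemma scaleR_fun_apply: "(c *\<^sub>R f) x = c *\<^sub>R f x"
  by (simp add: scaleR_fun_def)

lemmas fun_apply = sum_fun_apply scaleR_fun_apply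

lemma coset_eq_iff:
  assumes "subspace W"
  shows "x +o W = y +o W \<longleftrightarrow> x - y \<in> W"
proof
  assume "x +o W = y +o W"
  moreover have "x \<in> x +o W"
    using set_plus_intro2[of 0 W x] subspace_0[OF assms] by simp
  ultimately show "x - y \<in> W"
    by (simp add: set_plus_imp_minus)
next
  have sub: "a +o W \<subseteq> b +o W" if "a - b \<in> W" for a b
  proof
    fix c assume "c \<in> a +o W"
    then have "(c - a) + (a - b) \<in> W"
      using assms that by (blast intro: subspace_add set_plus_imp_minus)
    then show "c \<in> b +o W"
      by (intro set_minus_imp_plus) simp
  qed
  assume "x - y \<in> W"
  moreover have "y - x \<in> W"
    using subspace_neg[OF assms \<open>x - y \<in> W\<close>] by simp
  ultimately show "x +o W = y +o W"
    using sub by blast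
qed

lemma subspace_plus_self: "subspace W \<Longrightarrow> W + W = W"
proof
  show "W \<subseteq> W + W" if "subspace W"
    using that by (simp add: set_zero_plus2 subspace_0)
  show "W + W \<subseteq> W" if "subspace W"
    using that by (auto elim!: set_plus_elim intro: subspace_add)
qed

lemma coset_add: "subspace W \<Longrightarrow> (x +o W) + (y +o W) = (x + y) +o W"
  by (simp add: set_plus_rearrange subspace_plus_self)

lemma coset_scale_coset:
  assumes "subspace W"
  shows "coset_scale W c (x +o W) = (c *\<^sub>R x) +o W"
proof
  show "coset_scale W c (x +o W) \<subseteq> (c *\<^sub>R x) +o W"
  proof
    fix z assume "z \<in> coset_scale W c (x +o W)"
    then obtain a w where "a \<in> x +o W" "w \<in> W" "z = c *\<^sub>R a + w"
      by (auto simp: coset_scale_def elim!: set_plus_elim)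
    moreover from this have "c *\<^sub>R (a - x) + w \<in> W"
      using assms by (intro subspace_add subspace_scale set_plus_imp_minus)
    ultimately show "z \<in> (c *\<^sub>R x) +o W"
      by (intro set_minus_imp_plus) (simp add: algebra_simps)
  qed
  show "(c *\<^sub>R x) +o W \<subseteq> coset_scale W c (x +o W)"
  proof
    fix z assume "z \<in> (c *\<^sub>R x) +o W"
    then have "z - c *\<^sub>R x \<in> W"
      by (rule set_plus_imp_minus)
    moreover have "x \<in> x +o W"
      using set_plus_intro2[of 0 W x] subspace_0[OF assms] by simp
    ultimately have "c *\<^sub>R x + (z - c *\<^sub>R x) \<in> coset_scale W c (x +o W)"
      unfolding coset_scale_def by blast
    then show "z \<in> coset_scale W c (x +o W)" by simp
  qed
qed

definition clique :: "'a set \<Rightarrow> 'a set set" where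
  "clique J = {e. e \<subseteq> J \<and> card e = 2}"

lemma pairs_eq_clique: "pairs m = clique {1..m}"
  by (simp add: pairs_def clique_def)

lemma finite_clique: "finite J \<Longrightarrow> finite (clique J)"
  by (rule finite_subset[of _ "Pow J"]) (auto simp: clique_def)

lemma clique_mono: "J \<subseteq> K \<Longrightarrow> clique J \<subseteq> clique K"
  by (auto simp: clique_def)

lemma finite_pairs: "finite (pairs m)"
  by (simp add: pairs_eq_clique finite_clique)

lemma pair_in_clique: "{i, j} \<in> clique J \<longleftrightarrow> i \<in> J \<and> j \<in> J \<and> i \<noteq> j"
  by (auto simp: clique_def card_2_iff doubleton_eq_iff)

lemma cliqueE:
  assumes "e \<in> clique J"
  obtains i j where "e = {i, j}" "i \<in> J" "j \<in> J" "i \<noteq> j"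
  using assms by (auto simp: clique_def card_2_iff)

lemma flat_vector_apply: "finite F \<Longrightarrow> flat_vector F x = - of_bool (x \<in> F)"
  by (simp add: flat_vector_def fun_apply indicator_def of_bool_def)

lemma flat_vector_infinite: "infinite F \<Longrightarrow> flat_vector F = 0"
  by (simp add: flat_vector_def)

lemma flat_vector_outside: "x \<notin> F \<Longrightarrow> flat_vector F x = 0"
  by (cases "finite F") (simp_all add: flat_vector_apply flat_vector_infinite)

lemma subspace_coord_space: "subspace (coord_space S)"
  by (auto simp: subspace_def coord_space_def fun_apply)

lemma flat_vector_in_coord_space: "F \<subseteq> S \<Longrightarrow> flat_vector F \<in> coord_space S"
  by (auto simp: coord_space_def intro!: flat_vector_outside)

section \<open>Cuts, forests and paths\<close>

text \<open>A two-colouring that changes colour across \<open>e\<close> and across no other edge;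
  for \<open>e\<close> in \<open>E\<close> it witnesses that \<open>e\<close> is a bridge.
  Colourings are total functions, hence easier to evaluate and flip than paths.\<close>

definition is_cut :: "'a set set \<Rightarrow> 'a set \<Rightarrow> ('a \<Rightarrow> bool) \<Rightarrow> bool" where
  "is_cut E e \<chi> \<longleftrightarrow> (\<forall>x y. {x, y} \<in> E \<longrightarrow> (\<chi> x \<noteq> \<chi> y \<longleftrightarrow> {x, y} = e))"

section \<open>Connectedness and the edges of paths\<close>

definition connected_by :: "'a set set \<Rightarrow> ('a \<times> 'a) set" where
  "connected_by E = {(x, y). {x, y} \<in> E}\<^sup>*"

lemma connected_by_sym: "(u, v) \<in> connected_by E \<Longrightarrow> (v, u) \<in> connected_by E"
proof -
  have "sym {(x, y). {x, y} \<in> E}"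
    by (auto simp: sym_def insert_commute)
  then show "(u, v) \<in> connected_by E \<Longrightarrow> (v, u) \<in> connected_by E"
    unfolding connected_by_def by (blast dest: sym_rtrancl symD)
qed

lemma connected_by_refl [simp]: "(u, u) \<in> connected_by E"
  by (simp add: connected_by_def)

lemma connected_by_trans:
  "(u, v) \<in> connected_by E \<Longrightarrow> (v, w) \<in> connected_by E \<Longrightarrow> (u, w) \<in> connected_by E"
  unfolding connected_by_def by (rule rtrancl_trans)

lemma connected_by_edge: "{u, v} \<in> E \<Longrightarrow> (u, v) \<in> connected_by E"
  unfolding connected_by_def by blast

lemma path_edges_single [simp]: "path_edges [x] = {}"
  by (simp add: path_edges_def)

lemma path_edges_Nil [simp]: "path_edges [] = {}"
  by (simp add: path_edges_def)

lemma path_edges_Cons2 [simp]: "path_edges (x # y # p) = insert {x, y} (path_edges (y # p))"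
proof -
  have "{{(x # y # p) ! k, (x # y # p) ! Suc k} | k. Suc k < length (x # y # p)} =
      insert {x, y} {{(y # p) ! k, (y # p) ! Suc k} | k. Suc k < length (y # p)}" (is "?A = ?B")
  proof (intro equalityI subsetI)
    fix e assume "e \<in> ?A"
    then obtain k where "e = {(x # y # p) ! k, (y # p) ! k}" "k < length (y # p)"
      by auto
    then show "e \<in> ?B" by (cases k) auto
  next
    fix e assume "e \<in> ?B"
    then consider "e = {x, y}" | k where "e = {(y # p) ! k, (y # p) ! Suc k}" "Suc k < length (y # p)"
      by auto
    then show "e \<in> ?A"
    proof cases
      case 1
      then show ?thesis by (auto intro!: exI[of _ 0])
    next
      case 2
      then show ?thesis by (auto intro!: exI[of _ "Suc k"])
    qed
  qed
  then show ?thesis by (simp add: path_edges_def)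
qed

lemma path_edges_subset: "e \<in> path_edges p \<Longrightarrow> e \<subseteq> set p"
  by (auto simp: path_edges_def)

lemma path_edges_suffix: "path_edges q \<subseteq> path_edges (p @ q)"
proof (induction p)
  case (Cons x p)
  have "path_edges (p @ q) \<subseteq> path_edges (x # p @ q)"
    by (cases "p @ q") auto
  with Cons show ?case by auto
qed simp

text \<open>The colour changes only across \<open>e\<close>, and a path without repeated vertices
  crosses \<open>e\<close> at most once.\<close>

lemma cut_separates_path:
  assumes "is_cut E e \<chi>" "path_edges p \<subseteq> E" "distinct p" "p \<noteq> []"
  shows "e \<in> path_edges p \<longleftrightarrow> \<chi> (hd p) \<noteq> \<chi> (last p)"
  using assms(2-)
proof (induction p rule: induct_list012)
  case (3 x y p)
  \<comment> \<open>Crossing this edge a second time would revisit \<open>x\<close>.\<close>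
  have "{x, y} \<notin> path_edges (y # p)"
    using 3 path_edges_subset by fastforce
  moreover have "\<chi> x \<noteq> \<chi> y \<longleftrightarrow> {x, y} = e"
    using 3 assms(1) by (auto simp: is_cut_def)
  moreover have "e \<in> path_edges (y # p) \<longleftrightarrow> \<chi> y \<noteq> \<chi> (last (y # p))"
    using 3 by simp
  ultimately show ?case by auto
qed auto

lemma cut_constant_on_path:
  assumes "is_cut E f \<chi>" "path_edges p \<subseteq> E" "f \<notin> path_edges p" "x \<in> set p"
  shows "\<chi> x = \<chi> (hd p)"
  using assms(2-)
proof (induction p rule: induct_list012)
  case (3 y z p)
  then have "\<chi> y = \<chi> z"
    using assms(1) by (auto simp: is_cut_def)
  with 3 show ?case by auto
qed auto

text \<open>Loops are cut out while the path is being built: if the new vertex already occurs, only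
  the part from that occurrence on is kept.\<close>

lemma path_if_connected: "(u, v) \<in> connected_by E \<Longrightarrow> \<exists>p. is_path E u p v"
  unfolding connected_by_def
proof (induction rule: converse_rtrancl_induct)
  case base
  show ?case by (rule exI[of _ "[v]"]) (simp add: is_path_def)
next
  case (step u y)
  then obtain p where p: "is_path E y p v" by blast
  show ?case
  proof (cases "u \<in> set p")
    case True
    then obtain xs ys where "p = xs @ u # ys" by (meson split_list)
    then have "is_path E u (u # ys) v"
      using p path_edges_suffix[of "u # ys" xs] by (auto simp: is_path_def)
    then show ?thesis ..
  next
    case False
    then have "is_path E u (u # p) v"
      using p step(1) by (cases p) (auto simp: is_path_def)
    then show ?thesis ..
  qed
qed

lemma connected_if_path: "is_path E u p v \<Longrightarrow> (u, v) \<in> connected_by E"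
proof (induction p arbitrary: u rule: induct_list012)
  case (3 x y p)
  from 3(3) have "is_path E y (y # p) v" "{u, y} \<in> E" "x = u"
    by (auto simp: is_path_def)
  then show ?case
    using 3 by (blast intro: connected_by_trans connected_by_edge)
qed (auto simp: is_path_def)

text \<open>The closing edge of a cycle has differently coloured ends under its own cut, so the open
  path between these ends would have to contain that very edge.\<close>

lemma acyclic_if_cuts:
  assumes "\<And>e. e \<in> E \<Longrightarrow> \<exists>\<chi>. is_cut E e \<chi>"
  shows "acyclic_edges E"
  unfolding acyclic_edges_def
proof
  assume "\<exists>p. is_cycle E p"
  then obtain p where p: "3 \<le> length p" "distinct p" "path_edges p \<subseteq> E" "{last p, hd p} \<in> E"
    by (auto simp: is_cycle_def)
  then have "p \<noteq> []" by auto
  obtain \<chi> where \<chi>: "is_cut E {last p, hd p} \<chi>"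
    using assms[OF p(4)] by blast
  then have "{last p, hd p} \<in> path_edges p"
    using p \<open>p \<noteq> []\<close> cut_separates_path[OF \<chi>] by (auto simp: is_cut_def)
  then obtain k where "{last p, hd p} = {p ! k, p ! Suc k}" "Suc k < length p"
    by (auto simp: path_edges_def)
  then have "{p ! (length p - 1), p ! 0} = {p ! k, p ! Suc k}" "Suc k < length p"
    using \<open>p \<noteq> []\<close> by (simp_all add: hd_conv_nth last_conv_nth)
  moreover have "k < length p" "length p - 1 < length p" "0 < length p"
    using p calculation by auto
  \<comment> \<open>Vertices are distinct, so positions can be compared: first and last position
    would be consecutive, impossible for length at least 3.\<close>
  ultimately have "{length p - 1, 0} = {k, Suc k}"
    using nth_eq_iff_index_eq[OF p(2)] unfolding doubleton_eq_iff by metis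
  with p show False by (auto simp: doubleton_eq_iff)
qed

text \<open>A path bypassing the edge would be closed by it to a cycle.\<close>

lemma not_connected_without_edge:
  assumes "acyclic_edges E" "{u, v} \<in> E" "u \<noteq> v"
  shows "(u, v) \<notin> connected_by (E - {{u, v}})"
proof
  assume "(u, v) \<in> connected_by (E - {{u, v}})"
  then obtain p where p: "is_path (E - {{u, v}}) u p v"
    by (blast dest: path_if_connected)
  have "is_cycle E p"
  \<comment> \<open>The rule only serves to split into empty, one-element and longer lists. A path
    with just two vertices would use the removed edge.\<close>
  proof (cases p rule: remdups_adj.cases)
    case (3 x y q)
    then show ?thesis
      using p assms by (cases q) (auto simp: is_path_def is_cycle_def insert_commute)
  qed (use p assms in \<open>auto simp: is_path_def\<close>)
  with assms show False by (auto simp: acyclic_edges_def)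
qed

text \<open>Deleting \<open>e\<close> separates its ends, so the component of one end is a suitable
  colouring.\<close>

lemma cut_if_acyclic:
  assumes "acyclic_edges E" "e \<in> E" "card e = 2"
  shows "\<exists>\<chi>. is_cut E e \<chi> \<and> \<not> \<chi> r"
proof -
  obtain u v where e: "e = {u, v}" "u \<noteq> v"
    using assms by (auto simp: card_2_iff)
  define \<chi> where "\<chi> w \<longleftrightarrow> (u, w) \<in> connected_by (E - {e})" for w
  have uv: "\<chi> u" "\<not> \<chi> v"
    using not_connected_without_edge[of E u v] assms e by (auto simp: \<chi>_def)
  have "\<chi> x \<noteq> \<chi> y \<longleftrightarrow> {x, y} = e" if "{x, y} \<in> E" for x y
  proof (cases "{x, y} = e")
    case True
    then show ?thesis using uv e by (auto simp: doubleton_eq_iff)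
  next
    case False
    then have "(x, y) \<in> connected_by (E - {e})"
      using that by (auto intro: connected_by_edge)
    then show ?thesis
      using False unfolding \<chi>_def by (blast intro: connected_by_trans connected_by_sym)
  qed
  \<comment> \<open>Complemented if necessary, so that the root \<open>r\<close> is
    uncoloured.\<close>
  then have "is_cut E e (\<lambda>w. \<chi> w \<noteq> \<chi> r)"
    by (auto simp: is_cut_def)
  then show ?thesis by (intro exI conjI) auto
qed

text \<open>Every edge gets a cut. The new edge is cut by the component of \<open>u\<close>; the cut
  of an old edge may be changed on that whole component, since no old edge leaves it.\<close>

lemma acyclic_insert_edge:
  assumes "acyclic_edges E" "\<And>e. e \<in> E \<Longrightarrow> card e = 2" "(u, v) \<notin> connected_by E"
  shows "acyclic_edges (insert {u, v} E)"
proof (rule acyclic_if_cuts)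
  let ?con = "\<lambda>w. (u, w) \<in> connected_by E"
  have con: "?con x \<longleftrightarrow> ?con y" if "{x, y} \<in> E" for x y
    using that by (blast intro: connected_by_trans connected_by_edge connected_by_sym)
  fix e assume e: "e \<in> insert {u, v} E"
  have nin: "{u, v} \<notin> E"
    using assms(3) by (auto intro: connected_by_edge)
  show "\<exists>\<chi>. is_cut (insert {u, v} E) e \<chi>"
  proof (cases "e = {u, v}")
    case True
    have "is_cut (insert {u, v} E) e ?con"
      unfolding is_cut_def
    proof (intro allI impI)
      fix x y assume "{x, y} \<in> insert {u, v} E"
      then consider "{x, y} \<in> E" | "x = u" "y = v" | "x = v" "y = u"
        by (auto simp: doubleton_eq_iff)
      then show "?con x \<noteq> ?con y \<longleftrightarrow> {x, y} = e"
      proof cases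
        case 1
        then show ?thesis using con[OF 1] nin True by auto
      qed (use True assms(3) in \<open>auto simp: insert_commute\<close>)
    qed
    then show ?thesis by blast
  next
    case False
    then obtain \<chi> where \<chi>: "is_cut E e \<chi>"
      using e assms(1,2) cut_if_acyclic[of E e] by blast
    \<comment> \<open>flip the cut on the component of \<open>u\<close> if it separates \<open>u\<close> from \<open>v\<close>\<close>
    have "is_cut (insert {u, v} E) e (\<lambda>w. \<chi> w \<noteq> (?con w \<and> \<chi> u \<noteq> \<chi> v))"
      unfolding is_cut_def
    proof (intro allI impI)
      fix x y assume "{x, y} \<in> insert {u, v} E"
      then consider "{x, y} \<in> E" | "x = u" "y = v" | "x = v" "y = u"
        by (auto simp: doubleton_eq_iff)
      then show "((\<chi> x \<noteq> (?con x \<and> \<chi> u \<noteq> \<chi> v)) \<noteq> (\<chi> y \<noteq> (?con y \<and> \<chi> u \<noteq> \<chi> v))) \<longleftrightarrow> {x, y} = e"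
      proof cases
        case 1
        then show ?thesis using con[OF 1] \<chi> by (auto simp: is_cut_def)
      qed (use False assms(3) in \<open>auto simp: insert_commute\<close>)
    qed
    then show ?thesis by blast
  qed
qed

text \<open>The cut of the first edge of \<open>p\<close> separates \<open>u\<close> from
  \<open>v\<close>, so \<open>q\<close> uses this edge too, and only in its first step, as
  \<open>u\<close> does not recur.\<close>

lemma path_unique:
  assumes "\<And>e. e \<in> E \<Longrightarrow> \<exists>\<chi>. is_cut E e \<chi>" "is_path E u p v" "is_path E u q v"
  shows "p = q"
  using assms(2,3)
proof (induction p arbitrary: u q rule: induct_list012)
  case (2 x)
  then show ?case
    by (cases q rule: remdups_adj.cases) (auto simp: is_path_def split: if_splits)
next
  case (3 x x' p)
  have u: "x = u" "u \<noteq> v" "{u, x'} \<in> E" "u \<noteq> x'"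
    using 3(3) by (auto simp: is_path_def split: if_splits)
  then obtain \<chi> where \<chi>: "is_cut E {u, x'} \<chi>"
    using assms(1)[OF u(3)] by blast
  obtain y q' where q: "q = u # y # q'"
    using 3(4) u by (cases q rule: remdups_adj.cases) (auto simp: is_path_def)
  have "{u, x'} \<in> path_edges (x # x' # p)" using u by simp
  then have "\<chi> u \<noteq> \<chi> v"
    using cut_separates_path[OF \<chi>, of "x # x' # p"] 3(3) by (auto simp: is_path_def)
  then have "{u, x'} \<in> path_edges q"
    using cut_separates_path[OF \<chi>, of q] 3(4) by (auto simp: is_path_def)
  moreover have "{u, x'} \<notin> path_edges (y # q')"
    using path_edges_subset 3(4) q by (fastforce simp: is_path_def)
  ultimately have "x' = y"
    using u q by (auto simp: doubleton_eq_iff)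
  moreover have "x' # p = y # q'"
    using 3(3,4) q \<open>x' = y\<close> by (intro "3.IH"(2)[of y]) (auto simp: is_path_def)
  ultimately show ?case using u q by simp
qed (auto simp: is_path_def)

text \<open>Replaces the path chosen by \<open>THE\<close> by a sum over all edges, whose index set
  no longer depends on \<open>u\<close> and \<open>v\<close>; this makes distances accessible to
  linear algebra.\<close>

lemma tree_dist_eq_sum_cuts:
  assumes "finite E" "\<And>e. e \<in> E \<Longrightarrow> is_cut E e (\<chi> e)" "(u, v) \<in> connected_by E"
  shows "tree_dist E len u v = (\<Sum>e\<in>E. len e * of_bool (\<chi> e u \<noteq> \<chi> e v))"
proof -
  obtain p where p: "is_path E u p v"
    using path_if_connected[OF assms(3)] by blast
  then have "(THE p. is_path E u p v) = p"
    using path_unique[of E u _ v] assms(2) by (intro the_equality) metis+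
  moreover have "path_edges p = {e \<in> E. \<chi> e u \<noteq> \<chi> e v}"
    using p cut_separates_path[OF assms(2), of _ p] by (auto simp: is_path_def)
  ultimately show ?thesis
    using assms(1) by (auto simp: tree_dist_def intro!: sum.mono_neutral_cong_left)
qed

section \<open>Flats of complete graphs\<close>

lemma is_cycle_mono: "is_cycle E p \<Longrightarrow> E \<subseteq> E' \<Longrightarrow> is_cycle E' p"
  by (auto simp: is_cycle_def)

lemma acyclic_mono: "acyclic_edges E' \<Longrightarrow> E \<subseteq> E' \<Longrightarrow> acyclic_edges E"
  by (auto simp: acyclic_edges_def dest: is_cycle_mono)

lemma acyclic_empty: "acyclic_edges {}"
  by (simp add: acyclic_edges_def is_cycle_def)

lemma connected_by_mono: "E \<subseteq> E' \<Longrightarrow> connected_by E \<subseteq> connected_by E'"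
  unfolding connected_by_def by (rule rtrancl_mono) auto

lemma graphic_rank_attained:
  assumes "finite A"
  obtains I where "I \<subseteq> A" "graphic_indep S I" "card I = matroid_rank (graphic_indep S) A"
proof -
  have "finite {I. I \<subseteq> A \<and> graphic_indep S I}"
    using assms by (auto intro: finite_subset[of _ "Pow A"])
  moreover have "{} \<in> {I. I \<subseteq> A \<and> graphic_indep S I}"
    by (simp add: graphic_indep_def acyclic_empty)
  ultimately have "matroid_rank (graphic_indep S) A \<in> card ` {I. I \<subseteq> A \<and> graphic_indep S I}"
    unfolding matroid_rank_def by (intro Max_in) blast+
  then show thesis using that by auto
qed

lemma card_le_graphic_rank:
  assumes "finite A" "I \<subseteq> A" "graphic_indep S I"
  shows "card I \<le> matroid_rank (graphic_indep S) A"
  unfolding matroid_rank_def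
  using assms by (intro Max_ge) (auto intro: finite_subset[of _ "Pow A"])

text \<open>The sets of pairs that, completed by the diagonal, are equivalence relations.\<close>

definition transitive_edges :: "'a set set \<Rightarrow> bool" where
  "transitive_edges F \<longleftrightarrow> (\<forall>i j k. {i, j} \<in> F \<longrightarrow> {j, k} \<in> F \<longrightarrow> i \<noteq> k \<longrightarrow> {i, k} \<in> F)"

lemma transitive_edges_connected:
  assumes "transitive_edges F" "(i, k) \<in> connected_by F"
  shows "i = k \<or> {i, k} \<in> F"
  using assms(2) unfolding connected_by_def
  by (induction rule: rtrancl_induct) (use assms(1) in \<open>auto simp: transitive_edges_def\<close>)

text \<open>An exchange argument. A largest forest in \<open>insert {i, k} F\<close> must use
  \<open>{i, k}\<close>. Once this edge is removed, one of \<open>{i, j}\<close>,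
  \<open>{j, k}\<close> joins different components and can replace it, giving an equally large
  forest inside \<open>F\<close>, although \<open>{i, k}\<close> should raise the rank.\<close>

lemma transitive_if_flat_of_complete_graph:
  assumes "finite N" "is_flat (clique N) (graphic_indep (clique N)) F"
  shows "transitive_edges F"
  unfolding transitive_edges_def
proof (intro allI impI, rule ccontr)
  let ?S = "clique N"
  fix i j k assume ij: "{i, j} \<in> F" and jk: "{j, k} \<in> F" and "i \<noteq> k" and ik: "{i, k} \<notin> F"
  have F: "F \<subseteq> ?S" "finite F"
    using assms finite_clique[of N] by (auto simp: is_flat_def intro: finite_subset)
  then have "{i, k} \<in> ?S - F"
    using ij jk ik \<open>i \<noteq> k\<close> by (auto simp: pair_in_clique subset_iff)
  then have less: "matroid_rank (graphic_indep ?S) F < matroid_rank (graphic_indep ?S) (insert {i, k} F)"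
    using assms by (auto simp: is_flat_def)
  obtain I where I: "I \<subseteq> insert {i, k} F" "graphic_indep ?S I"
    "card I = matroid_rank (graphic_indep ?S) (insert {i, k} F)"
    using F graphic_rank_attained[of "insert {i, k} F" ?S] by auto
  have fin: "finite I" using I(1) F by (auto intro: finite_subset)
  have mem: "{i, k} \<in> I"
    using I less card_le_graphic_rank[of F I ?S] F by fastforce
  define J where "J = I - {{i, k}}"
  have J: "J \<subseteq> F" "acyclic_edges J" "\<And>e. e \<in> J \<Longrightarrow> card e = 2"
    using I F acyclic_mono[of I J] by (auto simp: J_def graphic_indep_def clique_def)
  have "(i, k) \<notin> connected_by J"
    using not_connected_without_edge[of I i k] I mem \<open>i \<noteq> k\<close>
    by (simp add: J_def graphic_indep_def)
  then have "(i, j) \<notin> connected_by J \<or> (j, k) \<notin> connected_by J"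
    by (blast intro: connected_by_trans)
  then obtain x y where xy: "{x, y} \<in> F" "(x, y) \<notin> connected_by J"
    using ij jk by metis
  then have "{x, y} \<notin> J" by (blast intro: connected_by_edge)
  moreover have "acyclic_edges (insert {x, y} J)"
    using acyclic_insert_edge[of J x y] J xy by simp
  ultimately have "card (insert {x, y} J) \<le> matroid_rank (graphic_indep ?S) F"
    using xy J F by (intro card_le_graphic_rank) (auto simp: graphic_indep_def)
  moreover have "card (insert {x, y} J) = card I"
    using \<open>{x, y} \<notin> J\<close> fin mem card_Suc_Diff1[OF fin mem] by (simp add: J_def)
  ultimately have "card I \<le> matroid_rank (graphic_indep ?S) F" by simp
  with less I show False by simp
qed

text \<open>By transitivity a largest forest in \<open>F\<close> never connects the ends of a pair
  outside \<open>F\<close>, so each such pair extends the forest.\<close>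

lemma flat_of_complete_graph_if_transitive:
  assumes "finite N" "F \<subseteq> clique N" "transitive_edges F"
  shows "is_flat (clique N) (graphic_indep (clique N)) F"
  unfolding is_flat_def
proof (intro conjI ballI)
  let ?S = "clique N"
  fix s assume s: "s \<in> ?S - F"
  then obtain i k where ik: "s = {i, k}" "i \<noteq> k" by (auto elim: cliqueE)
  have "finite F" using assms finite_clique[of N] by (auto intro: finite_subset)
  then obtain I where I: "I \<subseteq> F" "graphic_indep ?S I" "card I = matroid_rank (graphic_indep ?S) F"
    using graphic_rank_attained[of F ?S] by auto
  have "finite I" using I(1) \<open>finite F\<close> by (rule finite_subset)
  have "(i, k) \<notin> connected_by I"
    using transitive_edges_connected[OF assms(3), of i k] connected_by_mono[OF I(1)] s ik by auto
  then have "acyclic_edges (insert s I)"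
    using I acyclic_insert_edge[of I i k] ik by (auto simp: graphic_indep_def clique_def)
  then have "card (insert s I) \<le> matroid_rank (graphic_indep ?S) (insert s F)"
    using I s \<open>finite F\<close> by (intro card_le_graphic_rank) (auto simp: graphic_indep_def)
  moreover have "card (insert s I) = Suc (card I)"
    using s I \<open>finite I\<close> by (subst card_insert_disjoint) auto
  ultimately show "matroid_rank (graphic_indep ?S) F < matroid_rank (graphic_indep ?S) (insert s F)"
    using I by simp
qed (use assms in auto)

lemma flat_of_complete_graph_iff:
  "finite N \<Longrightarrow> is_flat (clique N) (graphic_indep (clique N)) F \<longleftrightarrow>
    F \<subseteq> clique N \<and> transitive_edges F"
  using transitive_if_flat_of_complete_graph[of N F] flat_of_complete_graph_if_transitive[of N F]
  by (auto simp: is_flat_def)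

section \<open>The comparison map\<close>

lemma phi_add: "phi n (a + b) = phi n a + phi n b"
  by (auto simp: phi_def fun_eq_iff sum.distrib)

lemma phi_scale: "phi n (c *\<^sub>R a) = c *\<^sub>R phi n a"
  by (auto simp: phi_def fun_eq_iff fun_apply sum_distrib_left)

lemma linear_phi: "linear (phi n)"
  by (rule linearI) (simp_all add: phi_add phi_scale)

lemma subspace_Im_phi: "subspace (Im_phi n)"
  unfolding Im_phi_def by (intro linear_subspace_image linear_phi subspace_coord_space)

lemma linear_comparison_map: "linear (comparison_map n)"
  by (rule linearI) (auto simp: comparison_map_def fun_eq_iff fun_apply)

lemma comparison_map_in_coord_space:
  assumes "a \<in> coord_space (pairs (n - 1))"
  shows "comparison_map n a \<in> coord_space (pairs n)"
proof -
  have "pairs (n - 1) \<subseteq> pairs n"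
    unfolding pairs_eq_clique by (rule clique_mono) auto
  then show ?thesis
    using assms by (auto simp: coord_space_def comparison_map_def)
qed

lemma subspace_all_ones_line: "subspace (all_ones_line S)"
  by (simp add: all_ones_line_def subspace_span)

lemma all_ones_line_iff: "x \<in> all_ones_line S \<longleftrightarrow> (\<exists>c. x = (\<lambda>e. c * indicator S e))"
  by (auto simp: all_ones_line_def span_singleton fun_eq_iff fun_apply)

lemma phi_pair: "i \<noteq> j \<Longrightarrow> {i, j} \<in> pairs n \<Longrightarrow> phi n a {i, j} = a i + a j"
  by (simp add: phi_def)

lemma pairs_cases_last:
  assumes "e \<in> pairs n"
  obtains i where "e = {i, n}" "i \<in> {1..n - 1}" "i \<noteq> n" | "n \<notin> e" "e \<in> pairs (n - 1)"
proof -
  obtain i j where e: "e = {i, j}" "i \<in> {1..n}" "j \<in> {1..n}" "i \<noteq> j"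
    using assms by (auto simp: pairs_eq_clique elim: cliqueE)
  show thesis
  proof (cases "i = n \<or> j = n")
    case True
    then show thesis
    proof
      assume "i = n"
      then show thesis using e by (intro that(1)[of j]) auto
    next
      assume "j = n"
      then show thesis using e by (intro that(1)[of i]) auto
    qed
  next
    case False
    then show thesis using e by (intro that(2)) (auto simp: pairs_eq_clique pair_in_clique)
  qed
qed

lemma pairs_pred_not_last: "e \<in> pairs (n - 1) \<Longrightarrow> n \<notin> e"
  by (fastforce simp: pairs_def)

text \<open>Yields both well-definedness and injectivity on the quotient: the zero entries at pairs
  containing n force x_i = - x_n for i < n, so all other entries equal - 2 x_n.\<close>

lemma comparison_map_in_Im_phi_iff:
  assumes "3 \<le> n" "a \<in> coord_space (pairs (n - 1))"
  shows "comparison_map n a \<in> Im_phi n \<longleftrightarrow> a \<in> all_ones_line (pairs (n - 1))"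
proof
  assume "comparison_map n a \<in> Im_phi n"
  then obtain x where x: "comparison_map n a = phi n x" by (auto simp: Im_phi_def)
  have xi: "x i = - x n" if "i \<in> {1..n - 1}" for i
  proof -
    have "{i, n} \<in> pairs n" "i \<noteq> n"
      using that assms(1) by (auto simp: pairs_eq_clique pair_in_clique)
    then have "comparison_map n a {i, n} = x i + x n"
      using x by (simp add: phi_pair)
    then show ?thesis by (simp add: comparison_map_def)
  qed
  have "a e = - x n * indicator (pairs (n - 1)) e" for e
  proof (cases "e \<in> pairs (n - 1)")
    case True
    then obtain i j where e: "e = {i, j}" "i \<in> {1..n - 1}" "j \<in> {1..n - 1}" "i \<noteq> j"
      by (auto simp: pairs_eq_clique elim: cliqueE)
    then have "{i, j} \<in> pairs n" by (auto simp: pairs_eq_clique pair_in_clique)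
    then have "comparison_map n a e = x i + x j"
      using x e by (simp add: phi_pair)
    then have "2 * a e = - 2 * x n"
      using xi e pairs_pred_not_last[OF True] by (simp add: comparison_map_def)
    then show ?thesis using True by simp
  next
    case False
    then show ?thesis using assms by (simp add: coord_space_def)
  qed
  then show "a \<in> all_ones_line (pairs (n - 1))"
    unfolding all_ones_line_iff by blast
next
  assume "a \<in> all_ones_line (pairs (n - 1))"
  then obtain c where c: "a = (\<lambda>e. c * indicator (pairs (n - 1)) e)"
    unfolding all_ones_line_iff by blast
  \<comment> \<open>Sums involving n cancel, all other sums are 2c.\<close>
  define x where "x i = (if i = n then - c else if i \<in> {1..n} then c else 0)" for i
  have "comparison_map n a = phi n x"
  proof
    fix e
    show "comparison_map n a e = phi n x e"
    proof (cases "e \<in> pairs n")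
      case True
      then show ?thesis
      proof (cases rule: pairs_cases_last)
        case (1 i)
        then show ?thesis using True
          by (auto simp: comparison_map_def phi_pair x_def)
      next
        case 2
        then obtain i j where e: "e = {i, j}" "i \<in> {1..n - 1}" "j \<in> {1..n - 1}" "i \<noteq> j"
          unfolding pairs_eq_clique by (elim cliqueE)
        then show ?thesis using True 2
          by (auto simp: comparison_map_def phi_pair x_def c)
      qed
    next
      case False
      then show ?thesis
        using comparison_map_in_coord_space[OF assms(2)] by (simp add: coord_space_def phi_def)
    qed
  qed
  moreover have "x \<in> coord_space {1..n}"
    using assms(1) by (auto simp: coord_space_def x_def)
  ultimately show "comparison_map n a \<in> Im_phi n" by (auto simp: Im_phi_def)
qed

text \<open>Subtracting \<open>phi n x\<close>, where x_i is the entry of b at \<open>{i, n}\<close>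
  and x_n = 0, clears the entries at n; the rest only has to be halved.\<close>

lemma comparison_map_surj:
  assumes "3 \<le> n" "b \<in> coord_space (pairs n)"
  shows "\<exists>a\<in>coord_space (pairs (n - 1)). b - comparison_map n a \<in> Im_phi n"
proof -
  define x where "x i = (if i \<in> {1..n - 1} then b {i, n} else 0)" for i
  define a where "a e = (if e \<in> pairs (n - 1) then (b e - phi n x e) / 2 else 0)" for e
  have "b - comparison_map n a = phi n x"
  proof
    fix e
    show "(b - comparison_map n a) e = phi n x e"
    proof (cases "e \<in> pairs n")
      case True
      then show ?thesis
      proof (cases rule: pairs_cases_last)
        case (1 i)
        then show ?thesis using True assms
          by (auto simp: comparison_map_def phi_pair x_def)
      next
        case 2
        then show ?thesis by (simp add: comparison_map_def a_def field_simps)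
      qed
    next
      case False
      then have "e \<notin> pairs (n - 1)"
        using clique_mono[of "{1..n - 1}" "{1..n}"] by (auto simp: pairs_eq_clique)
      then show ?thesis
        using False assms(2) by (simp add: coord_space_def phi_def comparison_map_def a_def)
    qed
  qed
  moreover have "x \<in> coord_space {1..n}" "a \<in> coord_space (pairs (n - 1))"
    by (auto simp: coord_space_def x_def a_def)
  ultimately show ?thesis by (auto simp: Im_phi_def)
qed

section \<open>The class of a curve\<close>

text \<open>With the leaf \<open>n\<close> as root, the distance of two leaves is the sum of their
  distances to the root minus twice the length of the part common to both paths. The sum lies in the
  image of \<open>phi n\<close>, and the common part gives the clique vectors.\<close>

lemma curve_class_eq:
  assumes fin: "finite (edges T)"
    and cut: "\<And>e. e \<in> edges T \<Longrightarrow> is_cut (edges T) e (\<chi> e)"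
    and root: "\<And>e. e \<in> edges T \<Longrightarrow> \<not> \<chi> e (leaf_end T n)"
    and con: "\<And>i j. i \<in> {1..n} \<Longrightarrow> j \<in> {1..n} \<Longrightarrow>
      (leaf_end T i, leaf_end T j) \<in> connected_by (edges T)"
  shows "curve_class n T len =
    comparison_map n (\<Sum>e\<in>edges T. len e *\<^sub>R flat_vector (clique {i \<in> {1..n - 1}. \<chi> e (leaf_end T i)}))
      +o Im_phi n"
proof -
  let ?J = "\<lambda>e. {i \<in> {1..n - 1}. \<chi> e (leaf_end T i)}"
  define a where "a = (\<Sum>e\<in>edges T. len e *\<^sub>R flat_vector (clique (?J e)))"
  \<comment> \<open>\<open>x i\<close> is the distance of the leaves \<open>i\<close> and \<open>n\<close>\<close>
  define x where "x i = (if i \<in> {1..n} then \<Sum>e\<in>edges T. len e * of_bool (\<chi> e (leaf_end T i)) else 0)" for i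
  have a_apply: "a p = (\<Sum>e\<in>edges T. - (len e * of_bool (p \<in> clique (?J e))))" for p
    by (simp add: a_def fun_apply flat_vector_apply finite_clique)
  have dist: "distance_vector n T len {i, j} =
      (\<Sum>e\<in>edges T. len e * of_bool (\<chi> e (leaf_end T i) \<noteq> \<chi> e (leaf_end T j)))"
    if "{i, j} \<in> pairs n" "i \<noteq> j" for i j
  proof -
    have "i \<in> {1..n}" "j \<in> {1..n}" using that by (auto simp: pairs_eq_clique pair_in_clique)
    then have "tree_dist (edges T) len (leaf_end T k) (leaf_end T l) =
        (\<Sum>e\<in>edges T. len e * of_bool (\<chi> e (leaf_end T k) \<noteq> \<chi> e (leaf_end T l)))"
      if "k = i \<and> l = j \<or> k = j \<and> l = i" for k l
      using that con by (intro tree_dist_eq_sum_cuts fin cut) auto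
    moreover have "Min {i, j} = i \<and> Max {i, j} = j \<or> Min {i, j} = j \<and> Max {i, j} = i"
      by (auto simp: min_def max_def)
    ultimately have "distance_vector n T len {i, j} = (\<Sum>e\<in>edges T. len e *
        of_bool (\<chi> e (leaf_end T (Min {i, j})) \<noteq> \<chi> e (leaf_end T (Max {i, j}))))"
      using that by (simp add: distance_vector_def)
    also have "\<dots> = (\<Sum>e\<in>edges T. len e * of_bool (\<chi> e (leaf_end T i) \<noteq> \<chi> e (leaf_end T j)))"
      by (intro sum.cong) (auto simp: min_def max_def)
    finally show ?thesis .
  qed
  have "distance_vector n T len - comparison_map n a = phi n x"
  proof
    fix p
    show "(distance_vector n T len - comparison_map n a) p = phi n x p"
    proof (cases "p \<in> pairs n")
      case True
      then show ?thesis
      proof (cases rule: pairs_cases_last)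
        case (1 i)
        then have "i \<in> {1..n}" "x n = 0"
          using root by (auto simp: x_def intro!: sum.neutral)
        with 1 True show ?thesis using root
          by (auto simp: comparison_map_def phi_pair dist x_def intro!: sum.cong)
      next
        case 2
        then obtain i j where p: "p = {i, j}" "i \<in> {1..n - 1}" "j \<in> {1..n - 1}" "i \<noteq> j"
          unfolding pairs_eq_clique by (elim cliqueE)
        have "(distance_vector n T len - comparison_map n a) p =
            (\<Sum>e\<in>edges T. len e * of_bool (\<chi> e (leaf_end T i) \<noteq> \<chi> e (leaf_end T j))) - 2 * a p"
          using p True 2 by (simp add: comparison_map_def dist)
        also have "\<dots> = (\<Sum>e\<in>edges T. len e * of_bool (\<chi> e (leaf_end T i)) +
            len e * of_bool (\<chi> e (leaf_end T j)))"
          unfolding a_apply sum_distrib_left sum_subtractf[symmetric]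
          using p by (intro sum.cong) (auto simp: pair_in_clique)
        also have "\<dots> = x i + x j"
          using p by (auto simp: x_def sum.distrib)
        also have "\<dots> = phi n x p"
          using p True by (simp add: phi_pair)
        finally show ?thesis .
      qed
    next
      case False
      then have "p \<notin> clique {1..n - 1}"
        using clique_mono[of "{1..n - 1}" "{1..n}"] by (auto simp: pairs_eq_clique)
      then have "p \<notin> clique (?J e)" for e
        using clique_mono[of "?J e" "{1..n - 1}"] by blast
      then show ?thesis
        using False by (simp add: distance_vector_def phi_def comparison_map_def a_apply)
    qed
  qed
  moreover have "x \<in> coord_space {1..n}" by (simp add: coord_space_def x_def)
  ultimately show ?thesis
    unfolding curve_class_def a_def[symmetric] coset_eq_iff[OF subspace_Im_phi]
    by (auto simp: Im_phi_def)
qed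

section \<open>From trees to chains of flats\<close>

text \<open>\<open>c t\<close> is the gap from \<open>t\<close> to the next larger element, and
  \<open>- Max T\<close> at the top. Only the top coefficient may be negative, just as only the
  coefficient of the ground set is free in \<open>chain_cone\<close>.\<close>

lemma real_set_as_tail_sums:
  assumes "finite (T :: real set)"
  shows "\<exists>c. (\<forall>t\<in>T. t < Max T \<longrightarrow> 0 \<le> c t) \<and> (\<forall>x\<in>T. x = - (\<Sum>t\<in>{t \<in> T. x \<le> t}. c t))"
  using assms
proof (induction T rule: finite_linorder_min_induct)
  case (insert b A)
  then obtain c where c: "\<forall>t\<in>A. t < Max A \<longrightarrow> 0 \<le> c t"
    "\<forall>x\<in>A. x = - (\<Sum>t\<in>{t \<in> A. x \<le> t}. c t)" by blast
  define c' where "c' = c(b := if A = {} then - b else Min A - b)"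
  have b: "b \<notin> A" using insert by auto
  have "0 \<le> c' t" if "t \<in> insert b A" "t < Max (insert b A)" for t
  proof -
    have "A \<noteq> {}" using that by auto
    then have "Max (insert b A) = Max A"
      using insert by (simp add: max_def order.strict_implies_order not_le)
    moreover have "b < Min A" using insert \<open>A \<noteq> {}\<close> by simp
    ultimately show ?thesis using that c \<open>A \<noteq> {}\<close> by (auto simp: c'_def)
  qed
  moreover have "x = - (\<Sum>t\<in>{t \<in> insert b A. x \<le> t}. c' t)" if x: "x \<in> insert b A" for x
  proof (cases "x = b")
    case False
    then have "{t \<in> insert b A. x \<le> t} = {t \<in> A. x \<le> t}" "x \<in> A"
      using insert x by auto
    moreover have "(\<Sum>t\<in>{t \<in> A. x \<le> t}. c' t) = (\<Sum>t\<in>{t \<in> A. x \<le> t}. c t)"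
      using b by (intro sum.cong) (auto simp: c'_def)
    ultimately show ?thesis using c by metis
  next
    case True
    have "{t \<in> insert b A. x \<le> t} = insert b A"
      using insert True by auto
    moreover have "(\<Sum>t\<in>A. c' t) = (\<Sum>t\<in>A. c t)"
      using b by (intro sum.cong) (auto simp: c'_def)
    moreover have "Min A = - (\<Sum>t\<in>A. c t)" if "A \<noteq> {}"
    proof -
      have "{t \<in> A. Min A \<le> t} = A" using insert(1) by auto
      then show ?thesis using c(2) Min_in[OF insert(1) that] by metis
    qed
    ultimately show ?thesis using True insert(1) b by (auto simp: c'_def)
  qed
  ultimately show ?case by blast
qed simp

text \<open>Layer-cake decomposition: \<open>e\<close> lies in the sublevel sets of exactly those
  thresholds that are at least \<open>a e\<close>, so its coordinate is the negated tail sum of the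
  gaps.\<close>

lemma sublevel_chain_cone:
  assumes "finite S" "S \<noteq> {}" "a \<in> coord_space S"
  shows "a \<in> chain_cone S ((\<lambda>t. {e \<in> S. a e \<le> t}) ` a ` S)"
proof -
  define T where "T = a ` S"
  define G where "G t = {e \<in> S. a e \<le> t}" for t
  have T: "finite T" "T \<noteq> {}" using assms by (auto simp: T_def)
  have finite_G: "finite (G t)" for t using assms(1) by (simp add: G_def)
  have Max_G: "Max (a ` G t) = t" if "t \<in> T" for t
    using that assms(1) by (intro Max_eqI) (auto simp: T_def G_def)
  \<comment> \<open>A threshold is recovered from its sublevel set, so sums over the chain become
    sums over thresholds.\<close>
  have inj: "inj_on G T"
    by (rule inj_on_inverseI[of _ "\<lambda>F. Max (a ` F)"]) (rule Max_G)
  have G_Max: "G (Max T) = S" using assms(1) by (auto simp: G_def T_def)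
  obtain c where c: "\<forall>t\<in>T. t < Max T \<longrightarrow> 0 \<le> c t"
    "\<forall>x\<in>T. x = - (\<Sum>t\<in>{t \<in> T. x \<le> t}. c t)"
    using real_set_as_tail_sums[OF T(1)] by blast
  define c' where "c' F = c (Max (a ` F))" for F
  have "a = (\<Sum>F\<in>G ` T. c' F *\<^sub>R flat_vector F)"
  proof
    fix e
    have "(\<Sum>F\<in>G ` T. c' F *\<^sub>R flat_vector F) e = (\<Sum>t\<in>T. c t * (- of_bool (e \<in> G t)))"
      using finite_G by (simp add: sum.reindex[OF inj] fun_apply c'_def Max_G flat_vector_apply)
    also have "\<dots> = a e"
    proof (cases "e \<in> S")
      case True
      have "(\<Sum>t\<in>T. c t * (- of_bool (e \<in> G t))) = - (\<Sum>t\<in>T. c t * of_bool (e \<in> G t))"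
        by (simp add: sum_negf)
      also have "(\<Sum>t\<in>T. c t * of_bool (e \<in> G t)) = (\<Sum>t\<in>{t \<in> T. a e \<le> t}. c t)"
        using True T by (intro sum.mono_neutral_cong_right) (auto simp: G_def)
      also have "- \<dots> = a e" using c(2) True by (simp add: T_def)
      finally show ?thesis .
    next
      case False
      then show ?thesis using assms(3) by (simp add: G_def coord_space_def)
    qed
    finally show "a e = (\<Sum>F\<in>G ` T. c' F *\<^sub>R flat_vector F) e" ..
  qed
  moreover have "0 \<le> c' F" if F: "F \<in> G ` T - {S}" for F
  proof -
    obtain t where t: "F = G t" "t \<in> T" "t \<noteq> Max T" using F G_Max by blast
    then have "t < Max T" using Max_ge[OF T(1) t(2)] by linarith
    then show ?thesis using c(1) t Max_G by (simp add: c'_def)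
  qed
  ultimately show ?thesis
    unfolding chain_cone_def T_def G_def by blast
qed

lemma ultrametric_in_chain_cone:
  assumes "finite N" "clique N \<noteq> {}" "a \<in> coord_space (clique N)"
    and ultra: "\<And>i j k. i \<in> N \<Longrightarrow> j \<in> N \<Longrightarrow> k \<in> N \<Longrightarrow> distinct [i, j, k] \<Longrightarrow>
      a {i, k} \<le> max (a {i, j}) (a {j, k})"
  shows "\<exists>C. flat_chain (clique N) (graphic_indep (clique N)) C \<and> a \<in> chain_cone (clique N) C"
proof -
  let ?S = "clique N"
  let ?G = "\<lambda>t. {e \<in> ?S. a e \<le> t}"
  let ?C = "?G ` a ` ?S"
  have fin: "finite ?S" using assms(1) by (rule finite_clique)
  have "transitive_edges (?G t)" for t
    unfolding transitive_edges_def
  proof (intro allI impI)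
    fix i j k assume h: "{i, j} \<in> ?G t" "{j, k} \<in> ?G t" "i \<noteq> k"
    then have "a {i, k} \<le> max (a {i, j}) (a {j, k})"
      by (intro ultra) (auto simp: pair_in_clique)
    with h show "{i, k} \<in> ?G t" by (auto simp: pair_in_clique)
  qed
  then have flat: "is_flat ?S (graphic_indep ?S) (?G t)" for t
    using flat_of_complete_graph_iff[OF assms(1)] by blast
  have "?G (Max (a ` ?S)) = ?S" using fin by auto
  moreover have "Max (a ` ?S) \<in> a ` ?S" using fin assms(2) by simp
  ultimately have "?S \<in> ?C" by (intro image_eqI[of _ _ "Max (a ` ?S)"]) simp_all
  moreover have "subset.chain {F. is_flat ?S (graphic_indep ?S) F \<and> F \<noteq> {}} ?C"
    unfolding subset_chain_def
  proof (intro conjI ballI)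
    \<comment> \<open>Thresholds are values of \<open>a\<close>, so no sublevel set is
      empty.\<close>
    show "?C \<subseteq> {F. is_flat ?S (graphic_indep ?S) F \<and> F \<noteq> {}}"
      using flat by blast
    fix X Y assume "X \<in> ?C" "Y \<in> ?C"
    then obtain s t where "X = ?G s" "Y = ?G t" by blast
    then show "X \<subseteq> Y \<or> Y \<subseteq> X" by (cases "s \<le> t") auto
  qed
  ultimately have "flat_chain ?S (graphic_indep ?S) ?C"
    using fin by (simp add: flat_chain_def)
  then show ?thesis
    using sublevel_chain_cone[OF fin assms(2,3)] by blast
qed

text \<open>The path from \<open>u\<close> to \<open>v\<close> crosses \<open>e\<close> but not
  \<open>f\<close>, so \<open>\<psi>\<close> is constant along it and in particular at the end
  \<open>x\<close> of \<open>e\<close>.\<close>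

lemma cut_constant_on_crossed_edge:
  assumes "is_cut E e \<chi>" "is_cut E f \<psi>" "e = {x, y}"
    and "(u, v) \<in> connected_by E" "\<chi> u \<noteq> \<chi> v" "\<psi> u = \<psi> v"
  shows "\<psi> x = \<psi> u"
proof -
  obtain p where p: "p \<noteq> []" "hd p = u" "last p = v" "distinct p" "path_edges p \<subseteq> E"
    using path_if_connected[OF assms(4)] by (auto simp: is_path_def)
  have "e \<in> path_edges p" "f \<notin> path_edges p"
    using p assms cut_separates_path[of E e \<chi> p] cut_separates_path[of E f \<psi> p] by auto
  then have "\<psi> x = \<psi> (hd p)"
    using cut_constant_on_path[OF assms(2) p(5)] path_edges_subset assms(3) by blast
  then show ?thesis using p by simp
qed

text \<open>If the coloured sides shared \<open>k\<close> without being nested, the path from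
  \<open>r\<close> to \<open>i\<close> would cross \<open>e\<close> where \<open>\<psi>\<close> is
  false and the path from \<open>k\<close> to \<open>j\<close> where it is true; an end of
  \<open>e\<close> would get both colours.\<close>

lemma rooted_cuts_laminar:
  assumes "is_cut E e \<chi>" "is_cut E f \<psi>" "card e = 2"
    and con: "(r, i) \<in> connected_by E" "(r, j) \<in> connected_by E" "(r, k) \<in> connected_by E"
    and "\<not> \<chi> r" "\<not> \<psi> r" "\<chi> k" "\<psi> k"
  shows "\<not> (\<chi> i \<and> \<not> \<psi> i \<and> \<not> \<chi> j \<and> \<psi> j)"
proof
  assume h: "\<chi> i \<and> \<not> \<psi> i \<and> \<not> \<chi> j \<and> \<psi> j"
  obtain x y where e: "e = {x, y}" using assms(3) by (auto simp: card_2_iff)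
  have "\<psi> x = \<psi> r"
    using h assms by (intro cut_constant_on_crossed_edge[OF assms(1,2) e con(1)]) auto
  moreover have "\<psi> x = \<psi> k"
    using h assms
    by (intro cut_constant_on_crossed_edge[OF assms(1,2) e, of k j])
      (auto intro: connected_by_trans connected_by_sym)
  ultimately show False using assms by simp
qed

section \<open>Marked trees and their rooted cuts\<close>

lemma finite_edges_of_tree: "is_tree V E \<Longrightarrow> finite E"
  by (rule finite_subset[of _ "Pow V"]) (auto simp: is_tree_def)

lemma connected_leaf_ends:
  assumes "is_marked_tree n T" "i \<in> {1..n}" "j \<in> {1..n}"
  shows "(leaf_end T i, leaf_end T j) \<in> connected_by (edges T)"
proof -
  have "leaf_end T i \<in> verts T" "leaf_end T j \<in> verts T" "is_tree (verts T) (edges T)"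
    using assms by (auto simp: is_marked_tree_def)
  then obtain p where "is_path (edges T) (leaf_end T i) p (leaf_end T j)"
    unfolding is_tree_def by metis
  then show ?thesis by (rule connected_if_path)
qed

lemma rooted_cuts_of_marked_tree:
  assumes "is_marked_tree n T" "1 \<le> n"
  obtains \<chi> where "\<And>e. e \<in> edges T \<Longrightarrow> is_cut (edges T) e (\<chi> e)"
    "\<And>e. e \<in> edges T \<Longrightarrow> \<not> \<chi> e (leaf_end T n)"
    "\<And>len. curve_class n T len = comparison_map n (\<Sum>e\<in>edges T.
      len e *\<^sub>R flat_vector (clique {i \<in> {1..n - 1}. \<chi> e (leaf_end T i)})) +o Im_phi n"
proof -
  have tree: "is_tree (verts T) (edges T)"
    using assms by (auto simp: is_marked_tree_def)
  have "finite (edges T)"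
    using tree by (rule finite_edges_of_tree)
  have "\<exists>\<chi>. \<forall>e\<in>edges T. is_cut (edges T) e (\<chi> e) \<and> \<not> \<chi> e (leaf_end T n)"
    using tree by (intro bchoice ballI cut_if_acyclic) (auto simp: is_tree_def)
  then obtain \<chi> where \<chi>: "\<forall>e\<in>edges T. is_cut (edges T) e (\<chi> e) \<and> \<not> \<chi> e (leaf_end T n)"
    by blast
  show thesis
    using \<chi> connected_leaf_ends[OF assms(1)] \<open>finite (edges T)\<close>
    by (intro that[of \<chi>] curve_class_eq) auto
qed

lemma curve_class_in_chain_cone:
  assumes "3 \<le> n" "is_marked_tree n T" "\<forall>e\<in>edges T. 0 \<le> len e"
  shows "\<exists>C a. flat_chain (pairs (n - 1)) (graphic_indep (pairs (n - 1))) C \<and>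
    a \<in> chain_cone (pairs (n - 1)) C \<and> curve_class n T len = comparison_map n a +o Im_phi n"
proof -
  let ?N = "{1..n - 1}"
  have tree: "is_tree (verts T) (edges T)"
    using assms by (auto simp: is_marked_tree_def)
  have fin: "finite (edges T)"
    using tree by (rule finite_edges_of_tree)
  have n1: "1 \<le> n" using assms(1) by simp
  obtain \<chi> where \<chi>: "\<And>e. e \<in> edges T \<Longrightarrow> is_cut (edges T) e (\<chi> e)"
    "\<And>e. e \<in> edges T \<Longrightarrow> \<not> \<chi> e (leaf_end T n)"
    "\<And>len. curve_class n T len = comparison_map n (\<Sum>e\<in>edges T.
      len e *\<^sub>R flat_vector (clique {i \<in> ?N. \<chi> e (leaf_end T i)})) +o Im_phi n"
    by (rule rooted_cuts_of_marked_tree[OF assms(2) n1]) auto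
  let ?\<chi> = "\<lambda>e i. \<chi> e (leaf_end T i)"
  define a where "a = (\<Sum>e\<in>edges T. len e *\<^sub>R flat_vector (clique {i \<in> ?N. ?\<chi> e i}))"
  have con: "(leaf_end T n, leaf_end T j) \<in> connected_by (edges T)" if "j \<in> ?N" for j
    using that assms(1) by (intro connected_leaf_ends[OF assms(2)]) auto
  \<comment> \<open>The edges common to the paths from leaf \<open>n\<close> to the leaves
    \<open>i\<close> and \<open>j\<close>.\<close>
  define A where "A i j = {e \<in> edges T. ?\<chi> e i \<and> ?\<chi> e j}" for i j
  have a_A: "a {i, j} = - (\<Sum>e\<in>A i j. len e)" if "i \<in> ?N" "j \<in> ?N" "i \<noteq> j" for i j
  proof -
    have "a {i, j} = (\<Sum>e\<in>edges T. - (len e * of_bool ({i, j} \<in> clique {i \<in> ?N. ?\<chi> e i})))"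
      by (simp add: a_def fun_apply flat_vector_apply finite_clique)
    also have "\<dots> = - (\<Sum>e\<in>edges T. len e * of_bool (?\<chi> e i \<and> ?\<chi> e j))"
      using that by (simp add: sum_negf pair_in_clique)
    also have "(\<Sum>e\<in>edges T. len e * of_bool (?\<chi> e i \<and> ?\<chi> e j)) = (\<Sum>e\<in>A i j. len e)"
      using fin by (intro sum.mono_neutral_cong_right) (auto simp: A_def)
    finally show ?thesis .
  qed
  have mono: "(\<Sum>e\<in>A i j. len e) \<le> (\<Sum>e\<in>A k l. len e)" if "A i j \<subseteq> A k l" for i j k l
    using that fin assms(3) by (intro sum_mono2) (auto simp: A_def)
  have "a {i, k} \<le> max (a {i, j}) (a {j, k})"
    if ijk: "i \<in> ?N" "j \<in> ?N" "k \<in> ?N" "distinct [i, j, k]" for i j k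
  proof -
    \<comment> \<open>Laminarity nests these sets, and the smaller one then lies in
      \<open>A i k\<close>, which is the ultrametric inequality.\<close>
    have "A i j \<subseteq> A j k \<or> A j k \<subseteq> A i j"
    proof (rule ccontr)
      assume "\<not> ?thesis"
      then obtain e f where ef: "e \<in> A i j" "e \<notin> A j k" "f \<in> A j k" "f \<notin> A i j" by blast
      then have "card e = 2" using tree by (auto simp: A_def is_tree_def)
      then have "\<not> (?\<chi> e i \<and> \<not> ?\<chi> f i \<and> \<not> ?\<chi> e k \<and> ?\<chi> f k)"
        using ef ijk by (intro rooted_cuts_laminar[OF \<chi>(1) \<chi>(1) _ con con con[of j]])
          (auto simp: A_def \<chi>(2))
      then show False using ef by (auto simp: A_def)
    qed
    then have "A i j \<subseteq> A i k \<or> A j k \<subseteq> A i k" by (auto simp: A_def)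
    then have "(\<Sum>e\<in>A i j. len e) \<le> (\<Sum>e\<in>A i k. len e) \<or> (\<Sum>e\<in>A j k. len e) \<le> (\<Sum>e\<in>A i k. len e)"
      using mono by blast
    then show ?thesis using a_A ijk by auto
  qed
  moreover have "a \<in> coord_space (clique ?N)"
    unfolding a_def by (intro subspace_sum subspace_scale subspace_coord_space
        flat_vector_in_coord_space clique_mono) auto
  moreover have "{1, 2} \<in> clique ?N" using assms(1) by (auto simp: pair_in_clique)
  ultimately show ?thesis
    using ultrametric_in_chain_cone[of ?N a] \<chi>(3)[of len]
    unfolding pairs_eq_clique a_def by blast
qed

section \<open>The tree of a laminar family\<close>

text \<open>The members become the inner vertices, with the ground set as root. Singletons are
  excluded because they stand for leaves.\<close>

locale laminar_family =
  fixes N :: "nat set" and \<B> :: "nat set set"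
  assumes finite_ground: "finite N"
    and ground_mem: "N \<in> \<B>"
    and subset_ground: "B \<in> \<B> \<Longrightarrow> B \<subseteq> N"
    and card_ge_2: "B \<in> \<B> \<Longrightarrow> 2 \<le> card B"
    and laminar: "A \<in> \<B> \<Longrightarrow> B \<in> \<B> \<Longrightarrow> A \<inter> B \<noteq> {} \<Longrightarrow> A \<subseteq> B \<or> B \<subseteq> A"
begin

definition parent :: "nat set \<Rightarrow> nat set" where
  "parent A = \<Inter> {B \<in> \<B>. A \<subset> B}"

text \<open>Vertices are encoded subsets, as trees have natural numbers as vertices. \<open>parent\<close> is also
  applied to singletons, which need not belong to the family.\<close>

definition parent_edge :: "nat set \<Rightarrow> nat set" where
  "parent_edge B = {set_encode B, set_encode (parent B)}"

text \<open>The subtree hanging at \<open>B\<close>, which is to be the coloured side of the edge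
  from \<open>B\<close> to its parent.\<close>

definition below :: "nat set \<Rightarrow> nat \<Rightarrow> bool" where
  "below B w \<longleftrightarrow> (\<exists>C\<in>\<B>. C \<subseteq> B \<and> w = set_encode C)"

text \<open>Leaf \<open>i\<close> is attached to the smallest member containing \<open>i\<close>; a
  label outside \<open>N\<close>, in the application \<open>n\<close>, goes to the root.\<close>

definition family_tree :: marked_tree where
  "family_tree = \<lparr>verts = set_encode ` \<B>, edges = parent_edge ` (\<B> - {N}),
    leaf_end = (\<lambda>i. if i \<in> N then set_encode (parent {i}) else set_encode N)\<rparr>"

lemma finite_family: "finite \<B>"
  using finite_ground subset_ground by (auto intro: finite_subset[of _ "Pow N"])

lemma finite_mem: "B \<in> \<B> \<Longrightarrow> finite B"
  using finite_ground subset_ground finite_subset by blast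

lemma encode_eq_iff: "A \<in> \<B> \<Longrightarrow> B \<in> \<B> \<Longrightarrow> set_encode A = set_encode B \<longleftrightarrow> A = B"
  by (simp add: set_encode_eq finite_mem)

lemma nonempty_mem: "B \<in> \<B> \<Longrightarrow> B \<noteq> {}"
  using card_ge_2 by fastforce

text \<open>The members strictly above a nonempty set meet, hence form a chain by laminarity, so
  their intersection is the least of them; \<open>N\<close> itself is one.\<close>

lemma parent_mem:
  assumes "A \<noteq> {}" "A \<subset> N"
  shows "parent A \<in> {B \<in> \<B>. A \<subset> B}"
proof -
  let ?S = "{B \<in> \<B>. A \<subset> B}"
  have "finite ?S" "?S \<noteq> {}" using finite_family ground_mem assms by auto
  then obtain M where M: "M \<in> ?S" "\<And>B. B \<in> ?S \<Longrightarrow> B \<subseteq> M \<Longrightarrow> M = B"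
    using finite_has_minimal[of ?S] by metis
  have "M \<subseteq> B" if B: "B \<in> ?S" for B
  proof -
    have "M \<inter> B \<noteq> {}" using M(1) B assms(1) by blast
    then show ?thesis using laminar[of M B] M B by blast
  qed
  then have "parent A = M" unfolding parent_def using M(1) by (intro equalityI) blast+
  with M show ?thesis by simp
qed

lemma parent_least: "B \<in> \<B> \<Longrightarrow> A \<subset> B \<Longrightarrow> parent A \<subseteq> B"
  by (auto simp: parent_def)

lemma parent_mem_family: "B \<in> \<B> - {N} \<Longrightarrow> parent B \<in> \<B>"
  and parent_psupset: "B \<in> \<B> - {N} \<Longrightarrow> B \<subset> parent B"
  using parent_mem[of B] nonempty_mem subset_ground by blast+

lemma singleton_psubset: "B \<in> \<B> \<Longrightarrow> i \<in> B \<Longrightarrow> {i} \<subset> B"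
  using card_ge_2[of B] by (cases "B = {i}") auto

lemma parent_singleton:
  assumes "i \<in> N"
  shows "parent {i} \<in> \<B>" "i \<in> parent {i}"
  using parent_mem[of "{i}"] singleton_psubset[OF ground_mem assms] by auto

lemma leaf_end_family_tree:
  "i \<in> N \<Longrightarrow> leaf_end family_tree i = set_encode (parent {i})"
  "i \<notin> N \<Longrightarrow> leaf_end family_tree i = set_encode N"
  by (simp_all add: family_tree_def)

lemma inj_on_parent_edge: "inj_on parent_edge (\<B> - {N})"
proof
  fix A B assume AB: "A \<in> \<B> - {N}" "B \<in> \<B> - {N}" "parent_edge A = parent_edge B"
  then consider "A = B" | "A = parent B" "parent A = B"
    using parent_mem_family by (auto simp: parent_edge_def doubleton_eq_iff encode_eq_iff)
  then show "A = B"
  proof cases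
    case 2
    then show ?thesis using AB parent_psupset by blast
  qed
qed

lemma below_encode: "C \<in> \<B> \<Longrightarrow> below B (set_encode C) \<longleftrightarrow> C \<subseteq> B"
  by (auto simp: below_def encode_eq_iff)

text \<open>The step from \<open>C\<close> to its parent leaves the subtree of \<open>B\<close> only
  for \<open>C = B\<close>, as a member strictly inside \<open>B\<close> has its parent inside
  \<open>B\<close>.\<close>

lemma cut_below:
  assumes "B \<in> \<B> - {N}"
  shows "is_cut (edges family_tree) (parent_edge B) (below B)"
  unfolding is_cut_def
proof (intro allI impI)
  fix x y assume "{x, y} \<in> edges family_tree"
  then obtain C where C: "C \<in> \<B> - {N}" "{x, y} = parent_edge C"
    by (auto simp: family_tree_def)
  have "C \<subseteq> B \<and> \<not> parent C \<subseteq> B \<longleftrightarrow> C = B" "parent C \<subseteq> B \<longrightarrow> C \<subseteq> B"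
    using parent_least[of B C] parent_psupset[OF C(1)] assms by blast+
  moreover have "below B x \<noteq> below B y \<longleftrightarrow> (C \<subseteq> B) \<noteq> (parent C \<subseteq> B)"
    using C parent_mem_family[OF C(1)] by (auto simp: parent_edge_def doubleton_eq_iff below_encode)
  moreover have "{x, y} = parent_edge B \<longleftrightarrow> C = B"
    using C assms inj_on_parent_edge by (auto dest: inj_onD)
  ultimately show "below B x \<noteq> below B y \<longleftrightarrow> {x, y} = parent_edge B" by blast
qed

lemma connected_to_ground:
  "B \<in> \<B> \<Longrightarrow> (set_encode B, set_encode N) \<in> connected_by (edges family_tree)"
proof (induction "card N - card B" arbitrary: B rule: less_induct)
  case less
  show ?case
  proof (cases "B = N")
    case False
    then have B: "B \<in> \<B> - {N}" using less by simp
    have "card B < card (parent B)" "card (parent B) \<le> card N"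
      using parent_psupset[OF B] parent_mem_family[OF B] finite_mem subset_ground finite_ground
      by (blast intro: psubset_card_mono card_mono)+
    then have "(set_encode (parent B), set_encode N) \<in> connected_by (edges family_tree)"
      using parent_mem_family[OF B] by (intro less(1)) auto
    moreover have "{set_encode B, set_encode (parent B)} \<in> edges family_tree"
      using B by (auto simp: family_tree_def parent_edge_def)
    ultimately show ?thesis by (blast intro: connected_by_trans connected_by_edge)
  qed simp
qed

lemma connected_family_tree:
  "u \<in> verts family_tree \<Longrightarrow> v \<in> verts family_tree \<Longrightarrow> (u, v) \<in> connected_by (edges family_tree)"
  using connected_to_ground
  by (auto simp: family_tree_def intro: connected_by_trans connected_by_sym)

lemma is_tree_family_tree: "is_tree (verts family_tree) (edges family_tree)"
  unfolding is_tree_def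
proof (intro conjI ballI)
  show "finite (verts family_tree)" "verts family_tree \<noteq> {}"
    using finite_family ground_mem by (auto simp: family_tree_def)
  show "\<exists>p. is_path (edges family_tree) u p v" if "u \<in> verts family_tree" "v \<in> verts family_tree" for u v
    using connected_family_tree[OF that] by (rule path_if_connected)
  show "acyclic_edges (edges family_tree)"
  proof (rule acyclic_if_cuts)
    fix e assume "e \<in> edges family_tree"
    then obtain B where "B \<in> \<B> - {N}" "e = parent_edge B" by (auto simp: family_tree_def)
    then show "\<exists>\<chi>. is_cut (edges family_tree) e \<chi>" using cut_below by blast
  qed
  fix e assume "e \<in> edges family_tree"
  then obtain B where B: "B \<in> \<B> - {N}" "e = parent_edge B" by (auto simp: family_tree_def)
  then have "B \<in> \<B>" "parent B \<in> \<B>" "B \<noteq> parent B"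
    using parent_mem_family[OF B(1)] parent_psupset[OF B(1)] by auto
  then show "e \<subseteq> verts family_tree" "card e = 2"
    using B by (auto simp: family_tree_def parent_edge_def encode_eq_iff)
qed

text \<open>The children of \<open>C\<close>, members or single leaves, cover \<open>C\<close>. A
  maximal candidate works: a parent strictly inside \<open>C\<close> would be a larger
  candidate.\<close>

lemma child_containing:
  assumes "C \<in> \<B>" "i \<in> C"
  shows "\<exists>A. (A \<in> \<B> - {N} \<or> A = {i}) \<and> parent A = C \<and> i \<in> A \<and> A \<subset> C"
proof -
  let ?S = "{A \<in> insert {i} \<B>. i \<in> A \<and> A \<subset> C}"
  have "finite ?S" "{i} \<in> ?S"
    using finite_family assms singleton_psubset by auto
  then obtain A where A: "A \<in> ?S" "\<And>B. B \<in> ?S \<Longrightarrow> A \<subseteq> B \<Longrightarrow> A = B"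
    using finite_has_maximal[of ?S] by (metis (no_types, lifting) empty_iff)
  then have "A \<noteq> {}" "A \<subset> N" using subset_ground[OF assms(1)] by auto
  then have P: "parent A \<in> \<B>" "A \<subset> parent A" using parent_mem[of A] by auto
  have "parent A \<subseteq> C" using A assms by (intro parent_least) auto
  moreover have "\<not> parent A \<subset> C"
    using A(2)[of "parent A"] P A(1) by auto
  ultimately show ?thesis using A \<open>A \<subset> N\<close> by blast
qed

text \<open>A child is a proper subset of \<open>C\<close>; the child containing an element that it
  misses is a second one.\<close>

lemma card_children_ge_2:
  assumes "C \<in> \<B>"
  shows "2 \<le> card {A \<in> \<B> - {N}. parent A = C} + card {i \<in> N. parent {i} = C}"
proof -
  let ?X = "{A \<in> \<B> - {N}. parent A = C}" and ?Y = "{i \<in> N. parent {i} = C}"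
  have fin: "finite ?X" "finite ?Y" using finite_family finite_ground by auto
  have child: "\<exists>A. A \<in> ?X \<union> (\<lambda>i. {i}) ` ?Y \<and> i \<in> A \<and> A \<subset> C" if "i \<in> C" for i
    using child_containing[OF assms that] that subset_ground[OF assms] by (auto 0 3)
  obtain i where "i \<in> C" using nonempty_mem[OF assms] by blast
  from child[OF this] obtain A where A: "A \<in> ?X \<union> (\<lambda>i. {i}) ` ?Y" "A \<subset> C" by auto
  then obtain j where "j \<in> C" "j \<notin> A" by auto
  from child[OF this(1)] obtain B where B: "B \<in> ?X \<union> (\<lambda>i. {i}) ` ?Y" "j \<in> B" by auto
  have "A \<noteq> B" using B(2) \<open>j \<notin> A\<close> by blast
  then have "2 = card {A, B}" by simp
  also have "\<dots> \<le> card (?X \<union> (\<lambda>i. {i}) ` ?Y)"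
    using A B fin by (intro card_mono) auto
  also have "\<dots> \<le> card ?X + card ((\<lambda>i. {i}) ` ?Y)" by (rule card_Un_le)
  also have "\<dots> \<le> card ?X + card ?Y" using fin by (intro add_left_mono card_image_le)
  finally show ?thesis .
qed

text \<open>Two children and one way up: the edge to the parent, or the leaf \<open>n\<close> at the
  root.\<close>

lemma valence_family_tree:
  assumes "C \<in> \<B>" "N = {1..n - 1}" "1 \<le> n"
  shows "3 \<le> valence n family_tree (set_encode C)"
proof -
  let ?X = "{A \<in> \<B> - {N}. parent A = C}" and ?Y = "{i \<in> N. parent {i} = C}"
  have fin: "finite ?X" "finite ?Y" using finite_family finite_ground by auto
  let ?X' = "if C = N then ?X else insert C ?X"
  let ?Y' = "if C = N then insert n ?Y else ?Y"
  have "C \<notin> ?X" using parent_psupset[of C] by blast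
  moreover have "n \<notin> ?Y" using assms by auto
  ultimately have "card ?X' + card ?Y' = Suc (card ?X + card ?Y)"
    using card_insert_disjoint[OF fin(1), of C] card_insert_disjoint[OF fin(2), of n]
    by (cases "C = N") (simp_all only: if_True if_False simp_thms add_Suc add_Suc_right)
  moreover have "card ?X' \<le> card {e \<in> edges family_tree. set_encode C \<in> e}"
  proof -
    have "card ?X' = card (parent_edge ` ?X')"
      using assms(1) by (intro card_image[symmetric] inj_on_subset[OF inj_on_parent_edge]) auto
    also have "\<dots> \<le> card {e \<in> edges family_tree. set_encode C \<in> e}"
      using finite_family assms(1)
      by (intro card_mono) (auto simp: family_tree_def parent_edge_def)
    finally show ?thesis .
  qed
  moreover have "card ?Y' \<le> card {i \<in> {1..n}. leaf_end family_tree i = set_encode C}"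
  proof -
    have N: "n \<notin> N" "N \<subseteq> {1..n}" using assms by auto
    have Y': "i \<in> {1..n} \<and> leaf_end family_tree i = set_encode C" if "i \<in> ?Y'" for i
    proof (cases "i = n")
      case True
      then have "C = N" using that N by (auto split: if_splits)
      then show ?thesis using True N(1) assms(3) by (simp add: leaf_end_family_tree(2))
    next
      case False
      then have "i \<in> N" "parent {i} = C" using that by (auto split: if_splits)
      then show ?thesis using N(2) leaf_end_family_tree(1)[of i] by auto
    qed
    have "?Y' \<subseteq> {i \<in> {1..n}. leaf_end family_tree i = set_encode C}"
      by (rule subsetI, rule CollectI, rule Y')
    then show ?thesis by (intro card_mono) simp_all
  qed
  ultimately show ?thesis
    using card_children_ge_2[OF assms(1)] by (simp add: valence_def)
qed

lemma is_marked_tree_family_tree: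
  assumes "N = {1..n - 1}" "1 \<le> n"
  shows "is_marked_tree n family_tree"
  unfolding is_marked_tree_def
proof (intro conjI ballI)
  show "leaf_end family_tree ` {1..n} \<subseteq> verts family_tree"
    using parent_singleton ground_mem by (auto simp: family_tree_def)
  show "3 \<le> valence n family_tree v" if "v \<in> verts family_tree" for v
    using that valence_family_tree[OF _ assms] by (auto simp: family_tree_def)
qed (rule is_tree_family_tree)

text \<open>The leaves beyond the edge of \<open>B\<close>, seen from the root, are exactly the
  elements of \<open>B\<close>, so each member other than \<open>N\<close> is realised by one
  edge.\<close>

lemma curve_class_family_tree:
  assumes "N = {1..n - 1}" "1 \<le> n"
  shows "curve_class n family_tree len =
    comparison_map n (\<Sum>B\<in>\<B> - {N}. len (parent_edge B) *\<^sub>R flat_vector (clique B)) +o Im_phi n"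
proof -
  let ?T = family_tree
  let ?inv = "the_inv_into (\<B> - {N}) parent_edge"
  let ?\<chi> = "\<lambda>e. below (?inv e)"
  have inv: "?inv (parent_edge B) = B" if "B \<in> \<B> - {N}" for B
    using the_inv_into_f_f[OF inj_on_parent_edge that] .
  have edgesE: "\<exists>B\<in>\<B> - {N}. e = parent_edge B" if "e \<in> edges ?T" for e
    using that by (auto simp: family_tree_def)
  have "curve_class n ?T len = comparison_map n (\<Sum>e\<in>edges ?T.
      len e *\<^sub>R flat_vector (clique {i \<in> {1..n - 1}. ?\<chi> e (leaf_end ?T i)})) +o Im_phi n"
  proof (rule curve_class_eq)
    show "finite (edges ?T)" using finite_family by (simp add: family_tree_def)
    show "is_cut (edges ?T) e (?\<chi> e)" if e: "e \<in> edges ?T" for e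
    proof -
      obtain B where "B \<in> \<B> - {N}" "e = parent_edge B" using edgesE[OF e] by blast
      then show ?thesis using inv[of B] cut_below[of B] by simp
    qed
    show "\<not> ?\<chi> e (leaf_end ?T n)" if e: "e \<in> edges ?T" for e
    proof -
      obtain B where B: "B \<in> \<B> - {N}" "e = parent_edge B" using edgesE[OF e] by blast
      have "n \<notin> N" using assms by auto
      moreover have "\<not> N \<subseteq> B" using B subset_ground by blast
      ultimately show ?thesis
        using inv[of B] B ground_mem by (simp add: leaf_end_family_tree below_encode)
    qed
    show "(leaf_end ?T i, leaf_end ?T j) \<in> connected_by (edges ?T)"
      if "i \<in> {1..n}" "j \<in> {1..n}" for i j
      using that is_marked_tree_family_tree[OF assms]
      by (intro connected_family_tree) (auto simp: is_marked_tree_def)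
  qed
  also have "(\<Sum>e\<in>edges ?T. len e *\<^sub>R flat_vector (clique {i \<in> {1..n - 1}. ?\<chi> e (leaf_end ?T i)})) =
      (\<Sum>B\<in>\<B> - {N}. len (parent_edge B) *\<^sub>R flat_vector (clique B))"
  proof -
    have "{i \<in> {1..n - 1}. ?\<chi> (parent_edge B) (leaf_end ?T i)} = B" if B: "B \<in> \<B> - {N}" for B
    proof -
      have "parent {i} \<subseteq> B \<longleftrightarrow> i \<in> B" if "i \<in> N" for i
        using parent_singleton[OF that] parent_least[of B "{i}"] singleton_psubset[of B i] B by blast
      then show ?thesis
        unfolding assms(1)[symmetric] using B subset_ground[of B] parent_singleton
        by (auto simp: inv[OF B] leaf_end_family_tree below_encode)
    qed
    then show ?thesis
      by (simp add: family_tree_def sum.reindex[OF inj_on_parent_edge])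
  qed
  finally show ?thesis .
qed

end

section \<open>From chains of flats to trees\<close>

text \<open>For transitive \<open>F\<close>, the class of \<open>i\<close> in the equivalence
  relation that completes \<open>F\<close> by the diagonal.\<close>

definition block :: "'a set \<Rightarrow> 'a set set \<Rightarrow> 'a \<Rightarrow> 'a set" where
  "block N F i = {j \<in> N. j = i \<or> {i, j} \<in> F}"

definition nontrivial_blocks :: "'a set \<Rightarrow> 'a set set \<Rightarrow> 'a set set" where
  "nontrivial_blocks N F = {block N F i | i. i \<in> N \<and> block N F i \<noteq> {i}}"

lemma pair_in_block:
  assumes "transitive_edges F" "x \<in> block N F i" "y \<in> block N F i" "x \<noteq> y"
  shows "{x, y} \<in> F"
proof (cases "x = i \<or> y = i")
  case True
  then show ?thesis using assms by (auto simp: block_def insert_commute)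
next
  case False
  then have "{x, i} \<in> F" "{i, y} \<in> F" using assms by (auto simp: block_def insert_commute)
  then show ?thesis using assms by (auto simp: transitive_edges_def)
qed

lemma block_eqI:
  assumes "transitive_edges F" "i \<in> N" "x \<in> block N F i"
  shows "block N F x = block N F i"
proof (intro equalityI subsetI)
  fix y assume y: "y \<in> block N F i"
  then have "y = x \<or> {x, y} \<in> F" using pair_in_block[OF assms(1,3)] by blast
  then show "y \<in> block N F x" using y by (auto simp: block_def)
next
  have "i \<in> block N F x" using assms by (auto simp: block_def insert_commute)
  fix y assume y: "y \<in> block N F x"
  then have "y = i \<or> {i, y} \<in> F"
    using pair_in_block[OF assms(1) \<open>i \<in> block N F x\<close>] by blast
  then show "y \<in> block N F i" using y by (auto simp: block_def)
qed

lemma block_mono: "F \<subseteq> G \<Longrightarrow> block N F i \<subseteq> block N G i"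
  by (auto simp: block_def)

lemma nontrivial_blocks_subset: "B \<in> nontrivial_blocks N F \<Longrightarrow> B \<subseteq> N"
  by (auto simp: nontrivial_blocks_def block_def)

lemma card_nontrivial_block:
  assumes "finite N" "B \<in> nontrivial_blocks N F"
  shows "2 \<le> card B"
proof -
  obtain i where i: "i \<in> N" "B = block N F i" "B \<noteq> {i}"
    using assms by (auto simp: nontrivial_blocks_def)
  then obtain j where "j \<in> B" "j \<noteq> i" by (auto simp: block_def)
  moreover have "i \<in> B" using i by (simp add: block_def)
  moreover have "finite B"
    using nontrivial_blocks_subset[OF assms(2)] assms(1) by (rule finite_subset)
  ultimately show ?thesis using card_mono[of B "{i, j}"] by simp
qed

text \<open>Both blocks may be based at a common point, where they inherit the inclusion of the
  flats. This is the source of laminarity.\<close>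

lemma block_nested:
  assumes "transitive_edges F" "transitive_edges G" "F \<subseteq> G"
    and "i \<in> N" "k \<in> N" "block N F i \<inter> block N G k \<noteq> {}"
  shows "block N F i \<subseteq> block N G k"
proof -
  obtain x where x: "x \<in> block N F i" "x \<in> block N G k" using assms by blast
  then have "block N F i = block N F x" "block N G k = block N G x"
    using block_eqI assms by metis+
  then show ?thesis using block_mono[OF assms(3)] by metis
qed

text \<open>The cliques on the nontrivial blocks partition \<open>F\<close>, so the vector of a flat
  splits into vectors that belong to single tree edges.\<close>

lemma flat_vector_eq_sum_blocks:
  assumes "finite N" "F \<subseteq> clique N" "transitive_edges F"
  shows "flat_vector F = (\<Sum>B\<in>nontrivial_blocks N F. flat_vector (clique B))"
proof
  fix p
  have fin: "finite F" "finite (nontrivial_blocks N F)"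
    using assms(1,2) finite_clique[of N] by (auto simp: nontrivial_blocks_def intro: finite_subset)
  have finB: "finite B" if "B \<in> nontrivial_blocks N F" for B
    using nontrivial_blocks_subset[OF that] assms(1) by (rule finite_subset)
  have "(\<Sum>B\<in>nontrivial_blocks N F. flat_vector (clique B) p) =
      (\<Sum>B\<in>nontrivial_blocks N F. - of_bool (p \<in> clique B))"
    by (intro sum.cong) (simp_all add: flat_vector_apply finite_clique finB)
  also have "\<dots> = - of_bool (p \<in> F)"
  proof (cases "p \<in> F")
    case True
    then obtain i j where p: "p = {i, j}" "i \<in> N" "j \<in> N" "i \<noteq> j"
      using assms(2) by (meson cliqueE subsetD)
    let ?B = "block N F i"
    have mem: "?B \<in> nontrivial_blocks N F" "p \<in> clique ?B"
      using p True by (auto simp: nontrivial_blocks_def pair_in_clique block_def)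
    have uniq: "B = ?B" if B: "B \<in> nontrivial_blocks N F" "p \<in> clique B" for B
    proof -
      obtain k where k: "k \<in> N" "B = block N F k" using B by (auto simp: nontrivial_blocks_def)
      then have "i \<in> block N F k" using B p by (auto simp: pair_in_clique)
      then show ?thesis using block_eqI[OF assms(3) k(1)] k(2) by simp
    qed
    have "(\<Sum>B\<in>nontrivial_blocks N F. - of_bool (p \<in> clique B)) =
        (\<Sum>B\<in>{?B}. - of_bool (p \<in> clique B) :: real)"
    proof (rule sum.mono_neutral_right[OF fin(2)])
      show "\<forall>B\<in>nontrivial_blocks N F - {?B}. - of_bool (p \<in> clique B) = (0::real)"
        using uniq by (simp add: Ball_def) blast
    qed (use mem in simp)
    then show ?thesis using True mem(2) by simp
  next
    case False
    have "p \<notin> clique B" if B: "B \<in> nontrivial_blocks N F" for B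
    proof
      assume "p \<in> clique B"
      then obtain x y where "p = {x, y}" "x \<in> B" "y \<in> B" "x \<noteq> y" by (rule cliqueE)
      then show False
        using B pair_in_block[OF assms(3)] False by (auto simp: nontrivial_blocks_def)
    qed
    then show ?thesis using False by simp
  qed
  also have "\<dots> = flat_vector F p" using fin by (simp add: flat_vector_apply)
  finally show "flat_vector F p = (\<Sum>B\<in>nontrivial_blocks N F. flat_vector (clique B)) p"
    by (simp add: fun_apply)
qed

text \<open>Ensures that no proper flat asks for an edge above the root.\<close>

lemma ground_not_nontrivial_block:
  assumes "F \<subseteq> clique N" "F \<noteq> clique N" "transitive_edges F"
  shows "N \<notin> nontrivial_blocks N F"
proof
  assume "N \<in> nontrivial_blocks N F"
  then obtain i where i: "N = block N F i" by (auto simp: nontrivial_blocks_def)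
  have "clique N \<subseteq> F"
  proof
    fix p assume "p \<in> clique N"
    then obtain x y where xy: "p = {x, y}" "x \<in> N" "y \<in> N" "x \<noteq> y" by (rule cliqueE)
    then have "x \<in> block N F i" "y \<in> block N F i" using i by simp_all
    then show "p \<in> F" using pair_in_block[OF assms(3)] xy by blast
  qed
  with assms show False by blast
qed

lemma comparison_map_coset_eq:
  assumes "3 \<le> n" "a - b \<in> all_ones_line (pairs (n - 1))" "a - b \<in> coord_space (pairs (n - 1))"
  shows "comparison_map n a +o Im_phi n = comparison_map n b +o Im_phi n"
  using comparison_map_in_Im_phi_iff[OF assms(1,3)] assms(2)
  by (simp add: coset_eq_iff[OF subspace_Im_phi] linear_diff[OF linear_comparison_map])

lemma flat_vector_ground_in_line:
  "finite S \<Longrightarrow> c *\<^sub>R flat_vector S \<in> all_ones_line S"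
  unfolding all_ones_line_iff
  by (rule exI[of _ "- c"]) (auto simp: fun_eq_iff fun_apply flat_vector_apply indicator_def)

text \<open>The coefficients of the chain turn into edge lengths; the free coefficient of the ground
  set vanishes modulo the line.\<close>

lemma chain_cone_in_moduli_space:
  assumes n: "3 \<le> n" and C: "flat_chain (pairs (n - 1)) (graphic_indep (pairs (n - 1))) C"
    and a: "a \<in> chain_cone (pairs (n - 1)) C"
  shows "comparison_map n a +o Im_phi n \<in> moduli_space n"
proof -
  define N where "N = {1..n - 1}"
  let ?S = "clique N"
  let ?nb = "nontrivial_blocks N"
  have S: "pairs (n - 1) = ?S" by (simp add: N_def pairs_eq_clique)
  note C = C[unfolded S] and a = a[unfolded S]
  have finN: "finite N" by (simp add: N_def)
  then have finS: "finite ?S" by (rule finite_clique)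
  have cardN: "2 \<le> card N" using n by (simp add: N_def)
  have finC: "finite C" and "?S \<in> C" using C by (auto simp: flat_chain_def)
  have CF: "F \<subseteq> ?S" "transitive_edges F" if "F \<in> C" for F
    using C that flat_of_complete_graph_iff[OF finN, of F]
    by (auto simp: flat_chain_def subset_chain_def)
  have nest: "F \<subseteq> G \<or> G \<subseteq> F" if "F \<in> C" "G \<in> C" for F G
    using C that by (auto simp: flat_chain_def subset_chain_def)
  obtain c where c: "a = (\<Sum>F\<in>C. c F *\<^sub>R flat_vector F)" "\<forall>F\<in>C - {?S}. 0 \<le> c F"
    using a by (auto simp: chain_cone_def)
  \<comment> \<open>Zero coefficients are dropped, since the lengths of a curve have to be
    positive.\<close>
  define C' where "C' = {F \<in> C - {?S}. 0 < c F}"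
  define \<B> where "\<B> = insert N (\<Union>F\<in>C'. ?nb F)"
  \<comment> \<open>A block may persist through several flats of the chain; its edge collects all
    their coefficients.\<close>
  define l where "l B = (\<Sum>F\<in>C'. c F * of_bool (B \<in> ?nb F))" for B
  have C': "finite C'" "C' \<subseteq> C" using finC by (auto simp: C'_def)
  interpret laminar_family N \<B>
  proof
    show "B \<subseteq> N" if "B \<in> \<B>" for B
      using that nontrivial_blocks_subset[of B N] by (auto simp: \<B>_def)
    then show "A \<subseteq> B \<or> B \<subseteq> A" if AB: "A \<in> \<B>" "B \<in> \<B>" "A \<inter> B \<noteq> {}" for A B
    proof (cases "A = N \<or> B = N")
      case False
      then obtain F G where FG: "F \<in> C'" "G \<in> C'" "A \<in> ?nb F" "B \<in> ?nb G"
        using AB by (auto simp: \<B>_def)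
      then obtain i k where ik: "i \<in> N" "A = block N F i" "k \<in> N" "B = block N G k"
        by (auto simp: nontrivial_blocks_def)
      have tr: "transitive_edges F" "transitive_edges G" using FG C' CF by blast+
      have "F \<subseteq> G \<or> G \<subseteq> F" using FG C' nest by blast
      then show ?thesis
      proof
        assume "F \<subseteq> G"
        then show ?thesis
          using block_nested[OF tr(1,2) _ ik(1,3)] AB(3) ik by simp
      next
        assume "G \<subseteq> F"
        then show ?thesis
          using block_nested[OF tr(2,1) _ ik(3,1)] AB(3) ik by (simp add: Int_commute)
      qed
    qed (use AB in blast)
    show "2 \<le> card B" if "B \<in> \<B>" for B
      using that cardN card_nontrivial_block[OF finN] by (auto simp: \<B>_def)
  qed (use finN in \<open>auto simp: \<B>_def\<close>)
  have "N \<notin> ?nb F" if "F \<in> C'" for F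
    using that CF[of F] ground_not_nontrivial_block[of F N] by (auto simp: C'_def)
  then have \<B>N: "\<B> - {N} = (\<Union>F\<in>C'. ?nb F)" by (auto simp: \<B>_def)
  have l_pos: "0 < l B" if B: "B \<in> \<B> - {N}" for B
  proof -
    obtain F where "F \<in> C'" "B \<in> ?nb F" using B \<B>N by blast
    then show ?thesis
      unfolding l_def using C'(1) by (intro sum_pos2[of _ F]) (auto simp: C'_def)
  qed
  let ?inv = "the_inv_into (\<B> - {N}) parent_edge"
  let ?len = "\<lambda>e. l (?inv e)"
  have inv: "?inv (parent_edge B) = B" if "B \<in> \<B> - {N}" for B
    using the_inv_into_f_f[OF inj_on_parent_edge that] .
  have nN: "N = {1..n - 1}" "1 \<le> n" using n by (simp_all add: N_def)
  have sum_C': "(\<Sum>B\<in>\<B> - {N}. l B *\<^sub>R flat_vector (clique B)) = (\<Sum>F\<in>C'. c F *\<^sub>R flat_vector F)"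
  proof -
    have "(\<Sum>B\<in>\<B> - {N}. l B *\<^sub>R flat_vector (clique B)) =
        (\<Sum>F\<in>C'. \<Sum>B\<in>\<B> - {N}. (c F * of_bool (B \<in> ?nb F)) *\<^sub>R flat_vector (clique B))"
      unfolding l_def scaleR_sum_left by (rule sum.swap)
    also have "\<dots> = (\<Sum>F\<in>C'. \<Sum>B\<in>?nb F. c F *\<^sub>R flat_vector (clique B))"
    proof (rule sum.cong[OF refl], rule sum.mono_neutral_cong_right)
      show "finite (\<B> - {N})" using finite_family by simp
      show "?nb F \<subseteq> \<B> - {N}" if "F \<in> C'" for F using that unfolding \<B>N by blast
    qed simp_all
    also have "\<dots> = (\<Sum>F\<in>C'. c F *\<^sub>R flat_vector F)"
    proof (rule sum.cong[OF refl])
      fix F assume "F \<in> C'"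
      then have "F \<in> C" using C' by blast
      then show "(\<Sum>B\<in>?nb F. c F *\<^sub>R flat_vector (clique B)) = c F *\<^sub>R flat_vector F"
        by (simp add: flat_vector_eq_sum_blocks[OF finN CF] scaleR_sum_right)
    qed
    finally show ?thesis .
  qed
  have a_eq: "a - (\<Sum>F\<in>C'. c F *\<^sub>R flat_vector F) = c ?S *\<^sub>R flat_vector ?S"
  proof -
    have "a = c ?S *\<^sub>R flat_vector ?S + (\<Sum>F\<in>C - {?S}. c F *\<^sub>R flat_vector F)"
      unfolding c(1) using finC \<open>?S \<in> C\<close> by (rule sum.remove)
    also have "(\<Sum>F\<in>C - {?S}. c F *\<^sub>R flat_vector F) = (\<Sum>F\<in>C'. c F *\<^sub>R flat_vector F)"
      using finC c(2) by (intro sum.mono_neutral_right) (auto simp: C'_def less_le)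
    finally show ?thesis by (simp only: diff_eq_eq)
  qed
  have "comparison_map n a +o Im_phi n =
      comparison_map n (\<Sum>F\<in>C'. c F *\<^sub>R flat_vector F) +o Im_phi n"
    by (rule comparison_map_coset_eq[OF n]; unfold S a_eq)
      (simp_all add: flat_vector_ground_in_line[OF finS] flat_vector_in_coord_space
        subspace_scale[OF subspace_coord_space])
  also have "(\<Sum>F\<in>C'. c F *\<^sub>R flat_vector F) =
      (\<Sum>B\<in>\<B> - {N}. ?len (parent_edge B) *\<^sub>R flat_vector (clique B))"
    unfolding sum_C'[symmetric] by (intro sum.cong) (simp_all add: inv)
  also have "comparison_map n \<dots> +o Im_phi n = curve_class n family_tree ?len"
    by (rule curve_class_family_tree[OF nN, symmetric])
  also have "\<dots> \<in> moduli_space n"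
  proof -
    have "0 < ?len e" if e: "e \<in> edges family_tree" for e
    proof -
      obtain B where "B \<in> \<B> - {N}" "e = parent_edge B"
        using e by (auto simp: family_tree_def)
      then show ?thesis using inv[of B] l_pos[of B] by simp
    qed
    then show ?thesis
      unfolding moduli_space_def using is_marked_tree_family_tree[OF nN] by blast
  qed
  finally show ?thesis .
qed

section \<open>The lattices\<close>

lemma int_combination_in_subgroup:
  assumes "subspace W" "linear f" "finite A"
    and gen: "\<And>i. i \<in> A \<Longrightarrow> f (g i) +o W \<in> generated_subgroup W G"
    and int: "\<And>i. i \<in> A \<Longrightarrow> c i \<in> \<int>"
  shows "f (\<Sum>i\<in>A. c i *\<^sub>R g i) +o W \<in> generated_subgroup W G"
proof -
  have zero: "f 0 +o W \<in> generated_subgroup W G"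
    by (simp add: linear_0[OF assms(2)] generated_subgroup.zero)
  have add: "f (x + y) +o W \<in> generated_subgroup W G"
    if "f x +o W \<in> generated_subgroup W G" "f y +o W \<in> generated_subgroup W G" for x y
    using generated_subgroup.add[OF that]
    by (simp add: coset_add[OF assms(1)] linear_add[OF assms(2)])
  have neg: "f (- x) +o W \<in> generated_subgroup W G" if "f x +o W \<in> generated_subgroup W G" for x
    using generated_subgroup.neg[OF that]
    by (simp add: coset_scale_coset[OF assms(1)] linear_neg[OF assms(2)])
  have nat: "f (real k *\<^sub>R x) +o W \<in> generated_subgroup W G"
    if "f x +o W \<in> generated_subgroup W G" for k x
    using zero add that by (induction k) (simp_all add: algebra_simps)
  have multiple: "f (c i *\<^sub>R g i) +o W \<in> generated_subgroup W G" if i: "i \<in> A" for i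
  proof -
    obtain z where z: "c i = of_int z" using int[OF i] by (auto elim: Ints_cases)
    then consider k where "c i = real k" | k where "c i = - real k"
      by (cases z rule: int_cases2) auto
    then show ?thesis
      using nat[OF gen[OF i]] neg by cases fastforce+
  qed
  have "f (\<Sum>i\<in>B. c i *\<^sub>R g i) +o W \<in> generated_subgroup W G" if "B \<subseteq> A" for B
    using finite_subset[OF that assms(3)] that
  proof (induction B rule: finite_induct)
    case empty
    then show ?case using zero by simp
  next
    case (insert i B)
    then show ?case using add[OF multiple[of i]] by simp
  qed
  then show ?thesis by blast
qed

lemma one_edge_curve_class:
  assumes "is_marked_tree n T" "1 \<le> n" "card (edges T) = 1" "\<forall>e\<in>edges T. len e = 1"
  obtains J where "J \<subseteq> {1..n - 1}"
    "curve_class n T len = comparison_map n (flat_vector (clique J)) +o Im_phi n"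
proof -
  obtain \<chi> where "\<And>e. e \<in> edges T \<Longrightarrow> is_cut (edges T) e (\<chi> e)"
    "\<And>e. e \<in> edges T \<Longrightarrow> \<not> \<chi> e (leaf_end T n)"
    and \<chi>: "\<And>len. curve_class n T len = comparison_map n (\<Sum>e\<in>edges T.
      len e *\<^sub>R flat_vector (clique {i \<in> {1..n - 1}. \<chi> e (leaf_end T i)})) +o Im_phi n"
    by (rule rooted_cuts_of_marked_tree[OF assms(1,2)]) auto
  obtain e where "edges T = {e}" using assms(3) by (auto simp: card_1_singleton_iff)
  then show thesis
    using \<chi>[of len] assms(4) by (intro that[of "{i \<in> {1..n - 1}. \<chi> e (leaf_end T i)}"]) auto
qed

text \<open>Up to sign this is a unit vector; if \<open>p\<close> is not the whole ground set of
  vertices, it comes from the curve whose bounded edge splits off the two leaves in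
  \<open>p\<close>.\<close>

lemma comparison_map_single_pair_in_lattice:
  assumes n: "3 \<le> n" and p: "p \<in> pairs (n - 1)"
  shows "comparison_map n (flat_vector {p}) +o Im_phi n \<in> moduli_lattice n"
proof -
  define N where "N = {1..n - 1}"
  have p_sub: "p \<subseteq> N" "card p = 2" using p by (auto simp: pairs_def N_def)
  have clique_p: "clique p = {p}"
    using p_sub finite_subset[of p N] card_subset_eq[of p] by (auto simp: clique_def N_def)
  show ?thesis
  proof (cases "p = N")
    \<comment> \<open>Here \<open>n = 3\<close> and no curve has a bounded edge, but the vector lies
      on the all-ones line, so its class is zero.\<close>
    case True
    then have "pairs (n - 1) = {p}" using clique_p by (simp add: N_def pairs_eq_clique)
    then have "comparison_map n (flat_vector {p}) +o Im_phi n = comparison_map n 0 +o Im_phi n"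
      using flat_vector_ground_in_line[of "{p}" 1] flat_vector_in_coord_space[of "{p}" "{p}"]
      by (intro comparison_map_coset_eq[OF n]) simp_all
    then show ?thesis
      by (simp add: linear_0[OF linear_comparison_map] moduli_lattice_def generated_subgroup.zero)
  next
    case False
    interpret laminar_family N "{N, p}"
      using n p_sub by unfold_locales (auto simp: N_def)
    have nN: "N = {1..n - 1}" "1 \<le> n" using n by (simp_all add: N_def)
    have Np: "{N, p} - {N} = {p}" using False by auto
    have "curve_class n family_tree (\<lambda>_. 1) = comparison_map n (flat_vector {p}) +o Im_phi n"
      using curve_class_family_tree[OF nN] clique_p by (simp add: Np)
    moreover have "card (edges family_tree) = 1" by (simp add: family_tree_def Np)
    ultimately show ?thesis
      unfolding moduli_lattice_def using is_marked_tree_family_tree[OF nN]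
      by (intro generated_subgroup.gen) (auto intro!: exI[of _ family_tree] exI[of _ "\<lambda>_. 1"])
  qed
qed

text \<open>Clique vectors are integral, which gives one inclusion; conversely the negated unit
  vectors \<open>flat_vector {p}\<close> already generate all integral vectors.\<close>

lemma moduli_lattice_eq:
  assumes n: "3 \<le> n"
  shows "moduli_lattice n = (\<lambda>a. comparison_map n a +o Im_phi n) ` int_coord_space (pairs (n - 1))"
    (is "_ = ?f ` ?Z")
proof (intro equalityI subsetI)
  fix A assume "A \<in> moduli_lattice n"
  then show "A \<in> ?f ` ?Z"
    unfolding moduli_lattice_def
  proof (induction rule: generated_subgroup.induct)
    case zero
    have "Im_phi n = ?f 0" by (simp add: linear_0[OF linear_comparison_map])
    then show ?case by (intro image_eqI) (auto simp: int_coord_space_def coord_space_def)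
  next
    case (gen A)
    then obtain T len where T: "A = curve_class n T len" "is_marked_tree n T"
      "card (edges T) = 1" "\<forall>e\<in>edges T. len e = 1" by auto
    obtain J where J: "J \<subseteq> {1..n - 1}" "curve_class n T len = ?f (flat_vector (clique J))"
      using one_edge_curve_class[OF T(2) _ T(3,4)] n by auto
    then have "finite J" "clique J \<subseteq> pairs (n - 1)"
      by (auto simp: pairs_eq_clique intro: finite_subset dest: clique_mono)
    then have "flat_vector (clique J) \<in> ?Z"
      using flat_vector_in_coord_space
      by (auto simp: int_coord_space_def flat_vector_apply finite_clique)
    then show ?case using T J by auto
  next
    case (add A B)
    then obtain a b where ab: "a \<in> ?Z" "b \<in> ?Z" "A = ?f a" "B = ?f b" by auto
    then have "A + B = ?f (a + b)"
      by (simp add: coset_add[OF subspace_Im_phi] linear_add[OF linear_comparison_map])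
    moreover have "a + b \<in> ?Z" using ab by (auto simp: int_coord_space_def coord_space_def)
    ultimately show ?case by blast
  next
    case (neg A)
    then obtain a where a: "a \<in> ?Z" "A = ?f a" by auto
    then have "coset_scale (Im_phi n) (- 1) A = ?f (- a)"
      by (simp add: coset_scale_coset[OF subspace_Im_phi] linear_neg[OF linear_comparison_map])
    moreover have "- a \<in> ?Z" using a by (auto simp: int_coord_space_def coord_space_def)
    ultimately show ?case by blast
  qed
next
  fix A assume "A \<in> ?f ` ?Z"
  then obtain a where a: "a \<in> ?Z" "A = ?f a" by blast
  have "a = (\<Sum>p\<in>pairs (n - 1). (- a p) *\<^sub>R flat_vector {p})"
  proof
    fix q
    have "(\<Sum>p\<in>pairs (n - 1). (- a p) *\<^sub>R flat_vector {p}) q = (\<Sum>p\<in>pairs (n - 1). if q = p then a p else 0)"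
      unfolding fun_apply by (intro sum.cong) (auto simp: flat_vector_apply)
    then show "a q = (\<Sum>p\<in>pairs (n - 1). (- a p) *\<^sub>R flat_vector {p}) q"
      using a by (auto simp: finite_pairs int_coord_space_def coord_space_def)
  qed
  moreover have "?f (\<Sum>p\<in>pairs (n - 1). (- a p) *\<^sub>R flat_vector {p}) \<in> moduli_lattice n"
    unfolding moduli_lattice_def
  proof (rule int_combination_in_subgroup[OF subspace_Im_phi linear_comparison_map finite_pairs])
    show "- a p \<in> \<int>" for p using a by (auto simp: int_coord_space_def)
  qed (rule comparison_map_single_pair_in_lattice[OF n, unfolded moduli_lattice_def])
  ultimately show "A \<in> moduli_lattice n" using a(2) by metis
qed

section \<open>The tropical isomorphism\<close>

lemma chain_cone_subset_coord_space:
  assumes "flat_chain S indep C"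
  shows "chain_cone S C \<subseteq> coord_space S"
proof -
  have "F \<subseteq> S" if "F \<in> C" for F
    using assms that by (auto simp: flat_chain_def subset_chain_def is_flat_def)
  then show ?thesis
    by (auto simp: chain_cone_def intro!: subspace_sum subspace_scale subspace_coord_space
        flat_vector_in_coord_space)
qed

text \<open>A cycle of three inclusions. It avoids contracting edges of length 0: such a curve is
  sent to a chain cone, and the tree rebuilt from there has positive lengths.\<close>

lemma support_moduli_fan:
  assumes n: "3 \<le> n"
  shows "support (moduli_fan n) = moduli_space n"
    and "moduli_space n = (\<lambda>a. comparison_map n a +o Im_phi n) `
      \<Union> {chain_cone (pairs (n - 1)) C | C. flat_chain (pairs (n - 1)) (graphic_indep (pairs (n - 1))) C}"
proof -
  let ?f = "\<lambda>a. comparison_map n a +o Im_phi n"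
  let ?B = "\<Union> {chain_cone (pairs (n - 1)) C | C. flat_chain (pairs (n - 1)) (graphic_indep (pairs (n - 1))) C}"
  have "moduli_space n \<subseteq> support (moduli_fan n)"
  proof
    fix A assume "A \<in> moduli_space n"
    then obtain T len where T: "A = curve_class n T len" "is_marked_tree n T" "\<forall>e\<in>edges T. 0 < len e"
      by (auto simp: moduli_space_def)
    then have "A \<in> type_cone n T" by (auto simp: type_cone_def less_imp_le)
    then show "A \<in> support (moduli_fan n)" using T(2) by (auto simp: support_def moduli_fan_def)
  qed
  moreover have "support (moduli_fan n) \<subseteq> ?f ` ?B"
  proof
    fix A assume "A \<in> support (moduli_fan n)"
    then obtain T len where "A = curve_class n T len" "is_marked_tree n T" "\<forall>e\<in>edges T. 0 \<le> len e"
      by (auto simp: support_def moduli_fan_def type_cone_def)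
    then show "A \<in> ?f ` ?B" using curve_class_in_chain_cone[OF n, of T len] by blast
  qed
  moreover have "?f ` ?B \<subseteq> moduli_space n"
    using chain_cone_in_moduli_space[OF n] by blast
  ultimately show "support (moduli_fan n) = moduli_space n" "moduli_space n = ?f ` ?B" by blast+
qed

theorem mainTheorem5:
  fixes n :: nat
  assumes "n \<ge> 3"
  defines "S \<equiv> pairs (n - 1)"
  defines "L \<equiv> all_ones_line S"
  defines "BK \<equiv> matroid_fan_mod_line S (graphic_indep S)"
  shows "\<exists>F. (\<forall>a\<in>coord_space S. F (a +o L) = comparison_map n a +o Im_phi n) \<and>
             quot_linear (coord_space S) L (coord_space (pairs n)) (Im_phi n) F \<and>
             bij_betw F (coset_space (coord_space S) L)
                        (coset_space (coord_space (pairs n)) (Im_phi n)) \<and>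
             bij_betw F ((\<lambda>x. x +o L) ` int_coord_space S) (moduli_lattice n) \<and>
             bij_betw F (support BK) (moduli_space n) \<and>
             tropical_isomorphism BK (moduli_fan n) F"
proof -
  let ?f = "\<lambda>a. comparison_map n a +o Im_phi n"
  let ?V = "coord_space S" and ?q = "\<lambda>a. a +o L"
  \<comment> \<open>The image of a coset of \<open>L\<close> is only a translate of the image of
    \<open>L\<close>; adding \<open>Im_phi n\<close> fills it up to a full coset without choosing
    representatives.\<close>
  define F where "F A = comparison_map n ` A + Im_phi n" for A
  have subL: "subspace L" by (simp add: L_def subspace_all_ones_line)
  have L_sub: "L \<subseteq> ?V"
    by (auto simp: L_def all_ones_line_iff coord_space_def)
  have in_Im: "comparison_map n a \<in> Im_phi n \<longleftrightarrow> a \<in> L" if "a \<in> ?V" for a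
    using comparison_map_in_Im_phi_iff[OF assms(1)] that by (simp add: S_def L_def)
  have F: "F (?q a) = ?f a" for a
  proof -
    have "comparison_map n ` ?q a = comparison_map n a +o comparison_map n ` L"
    proof -
      have "comparison_map n ` ?q a = (\<lambda>b. comparison_map n (a + b)) ` L"
        by (auto simp: elt_set_plus_def image_def)
      then show ?thesis
        by (auto simp: elt_set_plus_def linear_add[OF linear_comparison_map])
    qed
    then have "F (?q a) = comparison_map n a +o (comparison_map n ` L + Im_phi n)"
      by (simp add: F_def set_plus_rearrange3)
    moreover have "comparison_map n ` L + Im_phi n = Im_phi n"
    proof
      show "comparison_map n ` L + Im_phi n \<subseteq> Im_phi n"
      proof -
        have "comparison_map n ` L \<subseteq> Im_phi n" using in_Im L_sub by blast
        then have "comparison_map n ` L + Im_phi n \<subseteq> Im_phi n + Im_phi n"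
          by (rule set_plus_mono2) simp
        then show ?thesis by (simp only: subspace_plus_self[OF subspace_Im_phi])
      qed
      have "0 \<in> comparison_map n ` L"
        using subspace_0[OF subL] linear_0[OF linear_comparison_map] by (metis imageI)
      then show "Im_phi n \<subseteq> comparison_map n ` L + Im_phi n" by (rule set_zero_plus2)
    qed
    ultimately show ?thesis by simp
  qed
  have inj: "inj_on F (coset_space ?V L)"
  proof
    fix A B assume "A \<in> coset_space ?V L" "B \<in> coset_space ?V L" and eq: "F A = F B"
    then obtain a b where ab: "a \<in> ?V" "b \<in> ?V" "A = ?q a" "B = ?q b"
      by (auto simp: coset_space_def)
    then have "comparison_map n (a - b) \<in> Im_phi n"
      using eq by (simp add: F coset_eq_iff[OF subspace_Im_phi] linear_diff[OF linear_comparison_map])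
    moreover have "a - b \<in> ?V" using ab by (intro subspace_diff subspace_coord_space)
    ultimately show "A = B"
      using ab in_Im by (simp add: coset_eq_iff[OF subL])
  qed
  \<comment> \<open>Space, lattice and support are all given by sets of representatives, so each
    bijection reduces to computing \<open>?f\<close> on such a set.\<close>
  have bij: "bij_betw F (?q ` X) (?f ` X)" if "X \<subseteq> ?V" for X
    unfolding bij_betw_def
    using inj_on_subset[OF inj, of "?q ` X"] that by (auto simp: coset_space_def image_image F)
  have "?f ` ?V = coset_space (coord_space (pairs n)) (Im_phi n)"
  proof
    show "?f ` ?V \<subseteq> coset_space (coord_space (pairs n)) (Im_phi n)"
      using comparison_map_in_coord_space by (auto simp: coset_space_def S_def)
    show "coset_space (coord_space (pairs n)) (Im_phi n) \<subseteq> ?f ` ?V"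
    proof
      fix A assume "A \<in> coset_space (coord_space (pairs n)) (Im_phi n)"
      then obtain b where b: "b \<in> coord_space (pairs n)" "A = b +o Im_phi n"
        by (auto simp: coset_space_def)
      then obtain a where "a \<in> ?V" "b - comparison_map n a \<in> Im_phi n"
        using comparison_map_surj[OF assms(1)] by (auto simp: S_def)
      then show "A \<in> ?f ` ?V" using b coset_eq_iff[OF subspace_Im_phi] by blast
    qed
  qed
  then have bij_space: "bij_betw F (coset_space ?V L) (coset_space (coord_space (pairs n)) (Im_phi n))"
    using bij[of ?V] by (simp add: coset_space_def)
  have lin: "quot_linear ?V L (coord_space (pairs n)) (Im_phi n) F"
    unfolding quot_linear_def
  proof (intro conjI ballI allI)
    show "F ` coset_space ?V L \<subseteq> coset_space (coord_space (pairs n)) (Im_phi n)"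
      using bij_space by (simp add: bij_betw_def)
    show "F (A + B) = F A + F B" if "A \<in> coset_space ?V L" "B \<in> coset_space ?V L" for A B
      using that by (auto simp: coset_space_def coset_add[OF subL] F coset_add[OF subspace_Im_phi]
          linear_add[OF linear_comparison_map])
    show "F (coset_scale L c A) = coset_scale (Im_phi n) c (F A)" if "A \<in> coset_space ?V L" for c A
      using that by (auto simp: coset_space_def coset_scale_coset[OF subL] F
          coset_scale_coset[OF subspace_Im_phi] linear_scale[OF linear_comparison_map])
  qed
  have bij_lattice: "bij_betw F (?q ` int_coord_space S) (moduli_lattice n)"
    using bij[of "int_coord_space S"] moduli_lattice_eq[OF assms(1)]
    by (auto simp: int_coord_space_def S_def)
  have supp: "support BK = ?q ` \<Union> {chain_cone S C | C. flat_chain S (graphic_indep S) C}"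
    by (auto simp: BK_def matroid_fan_mod_line_def support_def L_def)
  have "\<Union> {chain_cone S C | C. flat_chain S (graphic_indep S) C} \<subseteq> ?V"
    using chain_cone_subset_coord_space by blast
  then have bij_support: "bij_betw F (support BK) (moduli_space n)"
    using bij support_moduli_fan(2)[OF assms(1)] by (simp add: supp S_def)
  \<comment> \<open>Both weights are constantly 1, so facets need not be matched.\<close>
  have "respects_weights BK (moduli_fan n) F"
    by (simp add: respects_weights_def BK_def matroid_fan_mod_line_def moduli_fan_def)
  then have "tropical_isomorphism BK (moduli_fan n) F"
    using lin bij_lattice bij_support support_moduli_fan(1)[OF assms(1)]
    by (simp add: tropical_isomorphism_def BK_def matroid_fan_mod_line_def moduli_fan_def L_def)
  then show ?thesis
    using F lin bij_space bij_lattice bij_support by blast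
qed

end
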